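(* Let $(M,\mathcal{T})$ be a tetra-regular triangulated closed 3-manifold with tetra-degree $d$ (that is, $d_i=d$ for all $i\in\mathcal{T}_0$). Consider the extended combinatorial Yamabe flow $\frac{dr_i}{dt}=-\widetilde{K}_i\sinh r_i$, $i\in\mathcal{T}_0$. (1) If $d\geq 23$, there exists a unique ball packing with vanishing combinatorial scalar curvature, and the solution to the extended flow converges exponentially fast to that ball packing for any initial data in $\mathbb{R}^N_+$. (2) If $d\leq 22$, there is no real or virtual ball packing with vanishing extended combinatorial scalar curvature, and the solution to the extended flow converges to zero as $t\to\infty$ for any initial data in $\mathbb{R}^N_+$.
   Context: $M$ is a closed 3-manifold with a (finite) triangulation $\mathcal{T}=\{\mathcal{T}_0,\mathcal{T}_1,\mathcal{T}_2,\mathcal{T}_3\}$ (vertices, edges, faces, tetrahedra), $\mathcal{T}_0=\{1,\dots,N\}$; $\{ijkl\}\in\mathcal{T}_3$ denotes the tetrahedron with vertices $i,j,k,l$. The tetra-degree $d_i$ is the number of tetrahedra incident to the vertex $i$. $\mathbb{R}_+=(0,\infty)$. A (hyperbolic) ball packing is a vector $\pmb{r}=(r_1,\dots,r_N)\in\mathbb{R}^N_+$. For $(r_i,r_j,r_k,r_l)\in\mathbb{R}_+^4$ write $y_a=\coth r_a$ and $Q=(y_i+y_j+y_k+y_l)^2-2(y_i^2+y_j^2+y_k^2+y_l^2)+4$. A non-degenerate tetrahedron in $\mathbb{H}^3$ (curvature $-1$) with edge lengths $l_{ab}=r_a+r_b$ exists iff $Q>0$ and is then unique up to isometry; in this case the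 tetrahedron is called real, otherwise virtual. A ball packing is real if all tetrahedra of $\mathcal{T}_3$ are real, and virtual otherwise. For a real tetrahedron $\alpha_{ijkl}$ is its solid angle at $i$ (sum of the three dihedral angles at the edges through $i$, minus $\pi$). For a real ball packing the combinatorial scalar curvature is $K_i=4\pi-\sum\alpha_{ijkl}$, summed over all tetrahedra incident to $i$; it is defined only for real ball packings, and vanishing means $K_i=0$ for all $i$. The set $\{Q\le 0\}\subset\mathbb{R}_+^4$ is the disjoint union of the four sets $D_a$, $a\in\{i,j,k,l\}$, where $D_a=\{y_a\geq y_b+y_c+y_d+2(y_by_c+y_cy_d+y_dy_b+1)^{1/2}\}$ with $\{a,b,c,d\}=\{i,j,k,l\}$. The extended solid angle at $i$ is $\widetilde\alpha_{ijkl}=\alpha_{ijkl}$ if $Q>0$, $\widetilde\alpha_{ijkl}=2\pi$ on $D_i$, and $\widetilde\alpha_{ijkl}=0$ on $D_j\cup D_k\cup D_l$. The extended combinatorial scalar curvature, defined for all ball packings, is $\widetilde{K}_i=4\pi-\sum\widetilde{\alpha}_{ijkl}$, summed over all tetrahedra incident to $i$. For every initial data in $\mathbb{R}^N_+$ the extended flow has a unique solution in $\mathbb{R}^N_+$, defined for all $t\in[0,\infty)$. Converging exponentially fast to $\overline{\pmb r}$ means $|\pmb r(t)-\overline{\pmb r}|\le Ce^{-\lambda t}$ for some $C,\lambda>0$ and all $t\ge 0$. *)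

theory Defs
  imports "HOL-Analysis.Analysis"
begin

section \<open>Triangulated closed 3-manifolds\<close>

definition closed_3_manifold :: "'a topology \<Rightarrow> bool" where
  "closed_3_manifold M \<longleftrightarrow>
     topspace M \<noteq> {} \<and> compact_space M \<and> Hausdorff_space M \<and> second_countable M \<and>
     (\<forall>x\<in>topspace M. \<exists>U (V :: (real^3) set).
        openin M U \<and> x \<in> U \<and> open V \<and> subtopology M U homeomorphic_space top_of_set V)"

text \<open>The vertex set is the finite type \<open>'n\<close>, so that \<open>N = CARD('n)\<close>; a simplex is identified
  with its set of vertices.\<close>

definition geometric_realization :: "'n::finite set set \<Rightarrow> (real^'n) set" where
  "geometric_realization T = (\<Union>\<sigma>\<in>T. convex hull ((\<lambda>i. axis i 1) ` \<sigma>))"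

definition triangulates :: "'n::finite set set \<Rightarrow> 'a topology \<Rightarrow> bool" where
  "triangulates T M \<longleftrightarrow>
     (\<forall>i. {i} \<in> T) \<and>
     (\<forall>\<sigma>\<in>T. \<sigma> \<noteq> {} \<and> card \<sigma> \<le> 4) \<and>
     (\<forall>\<sigma>\<in>T. \<forall>\<tau>. \<tau> \<noteq> {} \<and> \<tau> \<subseteq> \<sigma> \<longrightarrow> \<tau> \<in> T) \<and>
     top_of_set (geometric_realization T) homeomorphic_space M"

definition tetrahedra_at :: "'n::finite set set \<Rightarrow> 'n \<Rightarrow> 'n set set" where
  "tetrahedra_at T i = {\<sigma>\<in>T. card \<sigma> = 4 \<and> i \<in> \<sigma>}"

definition tetra_regular :: "'n::finite set set \<Rightarrow> nat \<Rightarrow> bool" where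
  "tetra_regular T d \<longleftrightarrow> (\<forall>i. card (tetrahedra_at T i) = d)"


section \<open>Hyperbolic tetrahedra\<close>

text \<open>Hyperboloid model of hyperbolic 3-space: the points \<open>(t, x)\<close> with
  \<open>|x|\<^sup>2 - t\<^sup>2 = -1\<close>, \<open>t > 0\<close>.\<close>

type_synonym minkowski = "real \<times> (real^3)"

definition lorentz :: "minkowski \<Rightarrow> minkowski \<Rightarrow> real" where
  "lorentz p q = snd p \<bullet> snd q - fst p * fst q"

definition hyperbolic_space :: "minkowski set" where
  "hyperbolic_space = {p. lorentz p p = -1 \<and> fst p > 0}"

definition hyperbolic_dist :: "minkowski \<Rightarrow> minkowski \<Rightarrow> real" where
  "hyperbolic_dist p q = arcosh (- lorentz p q)"

text \<open>The initial direction (up to a positive factor) of the geodesic from \<open>p\<close> to \<open>q\<close>.\<close>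

definition tangent_towards :: "minkowski \<Rightarrow> minkowski \<Rightarrow> minkowski" where
  "tangent_towards p q = q + lorentz p q *\<^sub>R p"

text \<open>The direction at \<open>p\<close>, perpendicular to the edge \<open>pq\<close>, pointing into the face \<open>pqu\<close>.\<close>

definition face_direction ::
    "minkowski \<Rightarrow> minkowski \<Rightarrow> minkowski \<Rightarrow> minkowski" where
  "face_direction p q u =
     (let e = tangent_towards p q; w = tangent_towards p u
      in w - (lorentz w e / lorentz e e) *\<^sub>R e)"

text \<open>The dihedral angle at the edge \<open>pq\<close> between the faces \<open>pqu\<close> and \<open>pqv\<close>.\<close>

definition dihedral_angle ::
    "minkowski \<Rightarrow> minkowski \<Rightarrow> minkowski \<Rightarrow> minkowski \<Rightarrow> real" where
  "dihedral_angle p q u v =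
     (let m = face_direction p q u; n = face_direction p q v
      in arccos (lorentz m n / sqrt (lorentz m m * lorentz n n)))"

text \<open>Four points of the hyperboloid lie on a common hyperbolic plane iff they lie on a common
  linear hyperplane, so non-degeneracy is linear independence.\<close>

definition packed_tetrahedron ::
    "real \<Rightarrow> real \<Rightarrow> real \<Rightarrow> real \<Rightarrow>
     minkowski \<Rightarrow> minkowski \<Rightarrow> minkowski \<Rightarrow> minkowski \<Rightarrow> bool"
  where
  "packed_tetrahedron ri rj rk rl p q u v \<longleftrightarrow>
     {p, q, u, v} \<subseteq> hyperbolic_space \<and> distinct [p, q, u, v] \<and> independent {p, q, u, v} \<and>
     hyperbolic_dist p q = ri + rj \<and> hyperbolic_dist p u = ri + rk \<and>
     hyperbolic_dist p v = ri + rl \<and> hyperbolic_dist q u = rj + rk \<and>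
     hyperbolic_dist q v = rj + rl \<and> hyperbolic_dist u v = rk + rl"

definition real_tetrahedron :: "real \<Rightarrow> real \<Rightarrow> real \<Rightarrow> real \<Rightarrow> bool" where
  "real_tetrahedron ri rj rk rl \<longleftrightarrow> (\<exists>p q u v. packed_tetrahedron ri rj rk rl p q u v)"

text \<open>The solid angle at the first vertex. It is meaningful only for a real tetrahedron, which is
  unique up to isometry.\<close>

definition solid_angle :: "real \<Rightarrow> real \<Rightarrow> real \<Rightarrow> real \<Rightarrow> real" where
  "solid_angle ri rj rk rl =
     (THE a. \<exists>p q u v. packed_tetrahedron ri rj rk rl p q u v \<and>
        a = dihedral_angle p q u v + dihedral_angle p u q v + dihedral_angle p v q u - pi)"


section \<open>Extended solid angles\<close>

definition coth :: "real \<Rightarrow> real" where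
  "coth x = cosh x / sinh x"

definition Q :: "real \<Rightarrow> real \<Rightarrow> real \<Rightarrow> real \<Rightarrow> real" where
  "Q ri rj rk rl =
     (coth ri + coth rj + coth rk + coth rl)\<^sup>2
     - 2 * ((coth ri)\<^sup>2 + (coth rj)\<^sup>2 + (coth rk)\<^sup>2 + (coth rl)\<^sup>2) + 4"

text \<open>The part of \<open>{Q \<le> 0}\<close> belonging to the first vertex.\<close>

definition in_D :: "real \<Rightarrow> real \<Rightarrow> real \<Rightarrow> real \<Rightarrow> bool" where
  "in_D ra rb rc rd \<longleftrightarrow>
     coth ra \<ge> coth rb + coth rc + coth rd
       + 2 * sqrt (coth rb * coth rc + coth rc * coth rd + coth rd * coth rb + 1)"

text \<open>On positive radii \<open>{Q \<le> 0}\<close> is the disjoint union of the four sets given by \<open>in_D\<close>, one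
  for each vertex, so the last branch covers exactly the three sets not belonging to the first
  vertex.\<close>

definition ext_solid_angle :: "real \<Rightarrow> real \<Rightarrow> real \<Rightarrow> real \<Rightarrow> real" where
  "ext_solid_angle ri rj rk rl =
     (if Q ri rj rk rl > 0 then solid_angle ri rj rk rl
      else if in_D ri rj rk rl then 2 * pi
      else 0)"


section \<open>Ball packings, curvature and the extended flow\<close>

definition ball_packing :: "real^'n::finite \<Rightarrow> bool" where
  "ball_packing r \<longleftrightarrow> (\<forall>i. r $ i > 0)"

definition real_packing :: "'n::finite set set \<Rightarrow> real^'n \<Rightarrow> bool" where
  "real_packing T r \<longleftrightarrow>
     ball_packing r \<and>
     (\<forall>i j k l. distinct [i, j, k, l] \<and> {i, j, k, l} \<in> T \<longrightarrow>
        real_tetrahedron (r $ i) (r $ j) (r $ k) (r $ l))"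

text \<open>The value at vertex \<open>i\<close> of the tetrahedron \<open>\<sigma>\<close> of an angle function \<open>f\<close> of four radii; it
  does not depend on the order of the other three vertices when \<open>f\<close> is symmetric in its last three
  arguments.\<close>

definition angle_at ::
    "(real \<Rightarrow> real \<Rightarrow> real \<Rightarrow> real \<Rightarrow> real) \<Rightarrow> real^'n::finite \<Rightarrow> 'n \<Rightarrow> 'n set \<Rightarrow> real" where
  "angle_at f r i \<sigma> =
     (THE a. \<exists>j k l. distinct [i, j, k, l] \<and> \<sigma> = {i, j, k, l} \<and>
        a = f (r $ i) (r $ j) (r $ k) (r $ l))"

text \<open>Meaningful only for real ball packings.\<close>

definition curvature :: "'n::finite set set \<Rightarrow> real^'n \<Rightarrow> 'n \<Rightarrow> real" where
  "curvature T r i = 4 * pi - (\<Sum>\<sigma>\<in>tetrahedra_at T i. angle_at solid_angle r i \<sigma>)"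

definition ext_curvature :: "'n::finite set set \<Rightarrow> real^'n \<Rightarrow> 'n \<Rightarrow> real" where
  "ext_curvature T r i = 4 * pi - (\<Sum>\<sigma>\<in>tetrahedra_at T i. angle_at ext_solid_angle r i \<sigma>)"

definition vanishing_curvature :: "'n::finite set set \<Rightarrow> real^'n \<Rightarrow> bool" where
  "vanishing_curvature T r \<longleftrightarrow> real_packing T r \<and> (\<forall>i. curvature T r i = 0)"

definition vanishing_ext_curvature :: "'n::finite set set \<Rightarrow> real^'n \<Rightarrow> bool" where
  "vanishing_ext_curvature T r \<longleftrightarrow> ball_packing r \<and> (\<forall>i. ext_curvature T r i = 0)"

definition ext_yamabe_flow ::
    "'n::finite set set \<Rightarrow> real^'n \<Rightarrow> (real \<Rightarrow> real^'n) \<Rightarrow> bool" where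
  "ext_yamabe_flow T r0 r \<longleftrightarrow>
     r 0 = r0 \<and>
     (\<forall>t\<ge>0. ball_packing (r t) \<and>
        (r has_vector_derivative (\<chi> i. - ext_curvature T (r t) i * sinh (r t $ i)))
          (at t within {0..}))"

definition converges_exponentially :: "(real \<Rightarrow> real^'n::finite) \<Rightarrow> real^'n \<Rightarrow> bool" where
  "converges_exponentially r rbar \<longleftrightarrow>
     (\<exists>C>0. \<exists>c>0. \<forall>t\<ge>0. norm (r t - rbar) \<le> C * exp (- c * t))"

end

theory Submission
  imports Defs
begin

text \<open>The proof is a maximum principle. Let \<open>\<omega>(r)\<close> be the solid angle of the regular tetrahedron with
  all radii \<open>r\<close>. The extended solid angle at a vertex is at most \<open>\<omega>(r\<^sub>i)\<close> when \<open>r\<^sub>i\<close> is the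
  largest radius of its tetrahedron and at least \<open>\<omega>(r\<^sub>i)\<close> when it is the smallest. With all tetra-degrees
  equal to \<open>d\<close>, the largest and the smallest radius along the flow are therefore compared with the
  scalar equation \<open>x' = (d \<omega>(x) - 4\<pi>) sinh x\<close>. Since \<open>\<omega>\<close> decreases strictly from the Euclidean value
  \<open>2 arccos (5 / (3\<surd>3))\<close>, which lies strictly between \<open>4\<pi>/23\<close> and \<open>4\<pi>/22\<close>, to \<open>0\<close>, this equation
  has an exponentially attracting positive equilibrium for \<open>d \<ge> 23\<close>, and all its solutions decay
  to \<open>0\<close> for \<open>d \<le> 22\<close>.

  Writing \<open>x, y, z\<close> for the cosines of the face angles at the vertex, the solid angle \<open>E\<close> satisfies
  \<open>cos (E/2) = (1 + x + y + z) / sqrt (2 (1 + x) (1 + y) (1 + z))\<close>. The comparison at the largest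
  radius only uses that \<open>x, y, z\<close> are at least the regular value; the one at the smallest radius needs
  the monotonicity in each of the other three radii, expressed by their hyperbolic cotangents.\<close>

section \<open>Spherical triangles\<close>

text \<open>Spherical law of cosines: in a triangle whose sides have cosines \<open>x\<close>,
  \<open>y\<close>, \<open>z\<close>, this is the cosine of the angle opposite the first
  side.\<close>

definition spherical_angle_cos :: "real \<Rightarrow> real \<Rightarrow> real \<Rightarrow> real" where
  "spherical_angle_cos x y z = (x - y * z) / sqrt ((1 - y\<^sup>2) * (1 - z\<^sup>2))"

text \<open>Determinant of the Gram matrix of three unit vectors with pairwise inner products
  \<open>x\<close>, \<open>y\<close>, \<open>z\<close>.\<close>

definition spherical_gram :: "real \<Rightarrow> real \<Rightarrow> real \<Rightarrow> real" where
  "spherical_gram x y z = 1 - x\<^sup>2 - y\<^sup>2 - z\<^sup>2 + 2 * x * y * z"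

text \<open>By Girard's theorem this is the area of the triangle, hence the solid angle it
  spans.\<close>

definition spherical_excess :: "real \<Rightarrow> real \<Rightarrow> real \<Rightarrow> real" where
  "spherical_excess x y z = arccos (spherical_angle_cos x y z)
     + arccos (spherical_angle_cos y x z) + arccos (spherical_angle_cos z x y) - pi"

text \<open>One identity gives all three parts: one minus the squared cosine is the Gram determinant
  over \<open>(1 - y\<^sup>2) * (1 - z\<^sup>2)\<close>.\<close>

lemma spherical_angle_cos_bound:
  assumes "spherical_gram x y z > 0" "y\<^sup>2 < 1" "z\<^sup>2 < 1"
  shows "(spherical_angle_cos x y z)\<^sup>2 < 1"
    and "\<bar>spherical_angle_cos x y z\<bar> < 1"
    and "sin (arccos (spherical_angle_cos x y z))
       = sqrt (spherical_gram x y z) / sqrt ((1 - y\<^sup>2) * (1 - z\<^sup>2))"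
proof -
  define D where "D = (1 - y\<^sup>2) * (1 - z\<^sup>2)"
  have D: "D > 0" using assms by (simp add: D_def)
  have eq: "1 - (spherical_angle_cos x y z)\<^sup>2 = spherical_gram x y z / D"
    using D unfolding spherical_angle_cos_def D_def[symmetric] power_divide
    by (simp add: field_simps) (simp add: D_def spherical_gram_def power2_eq_square algebra_simps)
  have "spherical_gram x y z / D > 0" using D assms by simp
  with eq show 1: "(spherical_angle_cos x y z)\<^sup>2 < 1" by linarith
  then show 2: "\<bar>spherical_angle_cos x y z\<bar> < 1" by (simp add: abs_square_less_1)
  show "sin (arccos (spherical_angle_cos x y z))
       = sqrt (spherical_gram x y z) / sqrt ((1 - y\<^sup>2) * (1 - z\<^sup>2))"
    using 2 eq by (subst sin_arccos) (auto simp: D_def real_sqrt_divide abs_less_iff)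
qed

text \<open>Dual cosine law: \<open>cos A + cos B cos C = x sin B sin C < sin B sin C\<close>, so
  \<open>cos A < cos (pi - B - C)\<close>.\<close>

lemma spherical_excess_bounds:
  assumes G: "spherical_gram x y z > 0" and x: "x\<^sup>2 < 1" and y: "y\<^sup>2 < 1" and z: "z\<^sup>2 < 1"
  shows "0 < spherical_excess x y z" "spherical_excess x y z < 2 * pi"
proof -
  define g where "g = sqrt (spherical_gram x y z)"
  have g: "g > 0" "g\<^sup>2 = spherical_gram x y z" using G by (simp_all add: g_def)
  have G': "spherical_gram y x z = spherical_gram x y z" "spherical_gram z x y = spherical_gram x y z"
    by (simp_all add: spherical_gram_def)
  note b1 = spherical_angle_cos_bound[OF G y z]
  note b2 = spherical_angle_cos_bound[of y x z, unfolded G', OF G x z]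
  note b3 = spherical_angle_cos_bound[of z x y, unfolded G', OF G x y]
  define A B C where "A = arccos (spherical_angle_cos x y z)"
    and "B = arccos (spherical_angle_cos y x z)" and "C = arccos (spherical_angle_cos z x y)"
  have cos: "cos A = spherical_angle_cos x y z" "cos B = spherical_angle_cos y x z"
    "cos C = spherical_angle_cos z x y"
    using b1 b2 b3 by (auto simp: A_def B_def C_def abs_less_iff)
  have ran: "0 < A" "A < pi" "0 < B" "B < pi" "0 < C" "C < pi"
    using b1 b2 b3 arccos_lt_bounded by (auto simp: A_def B_def C_def abs_less_iff)
  show "spherical_excess x y z < 2 * pi"
    using ran unfolding spherical_excess_def A_def[symmetric] B_def[symmetric] C_def[symmetric]
    by linarith
  define X Y Z where "X = sqrt (1 - x\<^sup>2)" and "Y = sqrt (1 - y\<^sup>2)" and "Z = sqrt (1 - z\<^sup>2)"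
  have XYZ: "X > 0" "Y > 0" "Z > 0" "X\<^sup>2 = 1 - x\<^sup>2" "Y\<^sup>2 = 1 - y\<^sup>2" "Z\<^sup>2 = 1 - z\<^sup>2"
    using x y z by (simp_all add: X_def Y_def Z_def)
  have sin: "sin B = g / (X * Z)" "sin C = g / (X * Y)"
    using b2 b3 by (simp_all add: B_def C_def g_def X_def Y_def Z_def real_sqrt_mult)
  have c: "cos A = (x - y * z) / (Y * Z)" "cos B = (y - x * z) / (X * Z)" "cos C = (z - x * y) / (X * Y)"
    by (simp_all add: cos spherical_angle_cos_def X_def Y_def Z_def real_sqrt_mult)
  have "cos A + cos B * cos C = (X\<^sup>2 * (x - y * z) + (y - x * z) * (z - x * y)) / (X\<^sup>2 * Y * Z)"
  proof -
    have "(x - y * z) / (Y * Z) = X\<^sup>2 * (x - y * z) / (X\<^sup>2 * Y * Z)"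
      using XYZ(1) by (simp add: mult.assoc)
    moreover have "(y - x * z) / (X * Z) * ((z - x * y) / (X * Y)) =
          (y - x * z) * (z - x * y) / (X\<^sup>2 * Y * Z)"
      by (simp add: power2_eq_square mult_ac)
    ultimately show ?thesis unfolding c by (simp add: add_divide_distrib)
  qed
  also have "\<dots> = x * g\<^sup>2 / (X\<^sup>2 * Y * Z)"
    unfolding XYZ g spherical_gram_def by (simp add: field_simps power2_eq_square)
  also have "\<dots> = x * (sin B * sin C)"
    using XYZ(1-3) by (simp add: sin field_simps power2_eq_square)
  finally have dual: "cos A + cos B * cos C = x * (sin B * sin C)" .
  have "sin B * sin C > 0" using ran by (simp add: sin_gt_zero)
  moreover have "x < 1" using x by (simp add: abs_square_less_1 abs_less_iff)
  ultimately have "cos A < cos (pi - (B + C))"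
    using dual mult_strict_right_mono[of x 1 "sin B * sin C"] by (simp add: cos_add)
  have "A > pi - (B + C)"
  proof (rule ccontr)
    assume "\<not> A > pi - (B + C)"
    then have "cos A \<ge> cos (pi - (B + C))"
      using ran by (intro cos_monotone_0_pi_le) auto
    with \<open>cos A < _\<close> show False by simp
  qed
  then show "0 < spherical_excess x y z"
    unfolding spherical_excess_def A_def[symmetric] B_def[symmetric] C_def[symmetric] by linarith
qed

text \<open>The numerators of the three \<open>cis\<close> values share the imaginary part
  \<open>g\<close>. Their product, negated because \<open>cis pi = -1\<close>, is a positive
  multiple of \<open>w\<^sup>2\<close>, so the argument of \<open>w\<close> is half the excess up to
  a multiple of pi.\<close>

lemma cis_spherical_excess:
  assumes G: "spherical_gram x y z > 0" and x: "x\<^sup>2 < 1" and y: "y\<^sup>2 < 1" and z: "z\<^sup>2 < 1"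
  defines "w \<equiv> Complex (1 + x + y + z) (sqrt (spherical_gram x y z))"
  shows "cis (spherical_excess x y z) = w\<^sup>2 / of_real ((cmod w)\<^sup>2)"
proof -
  define g where "g = sqrt (spherical_gram x y z)"
  have g: "g > 0" "g\<^sup>2 = spherical_gram x y z" using G by (simp_all add: g_def)
  have G': "spherical_gram y x z = spherical_gram x y z" "spherical_gram z x y = spherical_gram x y z"
    by (simp_all add: spherical_gram_def)
  note b1 = spherical_angle_cos_bound[OF G y z]
  note b2 = spherical_angle_cos_bound[of y x z, unfolded G', OF G x z]
  note b3 = spherical_angle_cos_bound[of z x y, unfolded G', OF G x y]
  define X Y Z where "X = sqrt (1 - x\<^sup>2)" and "Y = sqrt (1 - y\<^sup>2)" and "Z = sqrt (1 - z\<^sup>2)"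
  have XYZ: "X > 0" "Y > 0" "Z > 0" "X\<^sup>2 = 1 - x\<^sup>2" "Y\<^sup>2 = 1 - y\<^sup>2" "Z\<^sup>2 = 1 - z\<^sup>2"
    using x y z by (simp_all add: X_def Y_def Z_def)
  have 1: "cis (arccos (spherical_angle_cos x y z)) = Complex (x - y * z) g / of_real (Y * Z)"
    using b1 by (simp add: complex_eq_iff g_def Y_def Z_def real_sqrt_mult abs_less_iff)
      (simp add: spherical_angle_cos_def real_sqrt_mult)
  have 2: "cis (arccos (spherical_angle_cos y x z)) = Complex (y - x * z) g / of_real (X * Z)"
    using b2 by (simp add: complex_eq_iff g_def X_def Z_def real_sqrt_mult abs_less_iff)
      (simp add: spherical_angle_cos_def real_sqrt_mult)
  have 3: "cis (arccos (spherical_angle_cos z x y)) = Complex (z - x * y) g / of_real (X * Y)"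
    using b3 by (simp add: complex_eq_iff g_def X_def Y_def real_sqrt_mult abs_less_iff)
      (simp add: spherical_angle_cos_def real_sqrt_mult)
  have m: "(cmod w)\<^sup>2 = 2 * (1 + x) * (1 + y) * (1 + z)"
    using g by (simp add: w_def cmod_power2 g_def[symmetric])
      (simp add: spherical_gram_def power2_eq_square algebra_simps)
  \<comment> \<open>The positive factor by which the negated product of the three numerators differs
    from \<open>w\<^sup>2\<close>.\<close>
  define P where "P = (1 - x) * (1 - y) * (1 - z) / 2"
  have "cis (spherical_excess x y z) = - (Complex (x - y * z) g * Complex (y - x * z) g *
      Complex (z - x * y) g / of_real (X\<^sup>2 * Y\<^sup>2 * Z\<^sup>2))"
    using XYZ(1-3) by (simp add: spherical_excess_def flip: cis_mult cis_divide)
      (simp add: 1 2 3 power2_eq_square field_simps)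
  also have "\<dots> = w\<^sup>2 * of_real P / of_real (X\<^sup>2 * Y\<^sup>2 * Z\<^sup>2)"
  proof -
    have "- (Complex (x - y * z) g * Complex (y - x * z) g * Complex (z - x * y) g) = w\<^sup>2 * of_real P"
    proof (rule complex_eqI)
      have "(y - x * z) * (z - x * y) * (x - y * z) - g\<^sup>2 * ((y - x * z) + (z - x * y) + (x - y * z))
          = - (((1 + x + y + z)\<^sup>2 - g\<^sup>2) * P)"
        unfolding g P_def spherical_gram_def by (simp add: power2_eq_square field_simps)
      then show "Re (- (Complex (x - y * z) g * Complex (y - x * z) g * Complex (z - x * y) g))
        = Re (w\<^sup>2 * of_real P)"
        by (simp add: w_def g_def[symmetric] power2_eq_square algebra_simps)
      have "g\<^sup>2 - ((x - y * z) * (y - x * z) + (y - x * z) * (z - x * y) + (x - y * z) * (z - x * y))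
         = 2 * (1 + x + y + z) * P"
        unfolding g P_def spherical_gram_def by (simp add: power2_eq_square field_simps)
      then have "g * (g\<^sup>2 -
            ((x - y * z) * (y - x * z) + (y - x * z) * (z - x * y) + (x - y * z) * (z - x * y)))
         = g * (2 * (1 + x + y + z) * P)" by simp
      then show "Im (- (Complex (x - y * z) g * Complex (y - x * z) g * Complex (z - x * y) g))
        = Im (w\<^sup>2 * of_real P)"
        by (simp add: w_def g_def[symmetric] power2_eq_square algebra_simps)
    qed
    then show ?thesis by (metis minus_divide_left)
  qed
  also have "\<dots> = w\<^sup>2 * of_real (P / (X\<^sup>2 * Y\<^sup>2 * Z\<^sup>2))" by simp
  also have "P / (X\<^sup>2 * Y\<^sup>2 * Z\<^sup>2) = 1 / (cmod w)\<^sup>2"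
  proof -
    have *: "P * (cmod w)\<^sup>2 = X\<^sup>2 * Y\<^sup>2 * Z\<^sup>2"
    proof -
      have "P * (cmod w)\<^sup>2 = (2 * P) * ((1 + x) * (1 + y) * (1 + z))" unfolding m by simp
      also have "2 * P = (1 - x) * (1 - y) * (1 - z)" by (simp add: P_def)
      finally show ?thesis unfolding XYZ by (simp add: power2_eq_square algebra_simps)
    qed
    have "X\<^sup>2 * Y\<^sup>2 * Z\<^sup>2 > 0" using XYZ(1-3) by simp
    then have "P \<noteq> 0" unfolding *[symmetric] by auto
    then show ?thesis unfolding *[symmetric] by simp
  qed
  finally show ?thesis by simp
qed

definition half_excess_cos :: "real \<Rightarrow> real \<Rightarrow> real \<Rightarrow> real" where
  "half_excess_cos x y z = (1 + x + y + z) / sqrt (2 * (1 + x) * (1 + y) * (1 + z))"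

text \<open>The left side is the squared modulus of the \<open>w\<close> in
  \<open>cis_spherical_excess\<close>, so \<open>half_excess_cos\<close> is the real part of
  \<open>w\<close> over its modulus.\<close>

lemma gram_eq:
  "(1 + x + y + z)\<^sup>2 + spherical_gram x y z = 2 * (1 + x) * (1 + y) * (1 + z)"
  by (simp add: spherical_gram_def power2_eq_square algebra_simps)

text \<open>The double-angle formulas give the squared cosine of half the excess. Its sign is that
  of the numerator, since half the excess lies strictly between 0 and pi and has positive sine; on
  that range \<open>arccos\<close> inverts the cosine.\<close>

lemma spherical_excess_eq:
  assumes G: "spherical_gram x y z > 0" and x: "x\<^sup>2 < 1" and y: "y\<^sup>2 < 1" and z: "z\<^sup>2 < 1"
  shows "spherical_excess x y z = 2 * arccos (half_excess_cos x y z)"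
proof -
  define g where "g = sqrt (spherical_gram x y z)"
  define n where "n = 1 + x + y + z"
  define m where "m = 2 * (1 + x) * (1 + y) * (1 + z)"
  define h where "h = spherical_excess x y z / 2"
  have g: "g > 0" "g\<^sup>2 = spherical_gram x y z" using G by (simp_all add: g_def)
  have m: "n\<^sup>2 + g\<^sup>2 = m" using gram_eq by (simp add: n_def m_def g)
  then have "m > 0" using g(1) by (metis add_nonneg_pos zero_le_power2 zero_less_power)
  have h: "0 < h" "h < pi" using spherical_excess_bounds[OF assms] by (auto simp: h_def)
  then have "sin h > 0" by (simp add: sin_gt_zero)
  have "(cmod (Complex n g))\<^sup>2 = m" by (simp add: cmod_power2 m)
  then have "cis (2 * h) = (Complex n g)\<^sup>2 / of_real m"
    using cis_spherical_excess[OF assms, folded g_def n_def] by (simp add: h_def)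
  then have cs: "cos (2 * h) = (n\<^sup>2 - g\<^sup>2) / m" "sin (2 * h) = 2 * n * g / m"
    by (simp_all add: complex_eq_iff Re_divide_of_real Im_divide_of_real power2_eq_square mult_ac)
  have "2 * (cos h)\<^sup>2 = 1 + (n\<^sup>2 - g\<^sup>2) / m"
    using cs(1) unfolding cos_double_cos by linarith
  also have "\<dots> = (m + (n\<^sup>2 - g\<^sup>2)) / m"
    using \<open>m > 0\<close> by (simp add: add_divide_distrib)
  also have "\<dots> = 2 * (n\<^sup>2 / m)" using m by simp
  finally have c2: "(cos h)\<^sup>2 = n\<^sup>2 / m" by simp
  have s: "sin h * cos h = n * g / m"
    using cs(2) unfolding sin_double by simp
  have "cos h = n / sqrt m"
  proof -
    have "(cos h)\<^sup>2 = (n / sqrt m)\<^sup>2"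
      using c2 \<open>m > 0\<close> by (simp add: power_divide)
    then have "\<bar>cos h\<bar> = \<bar>n / sqrt m\<bar>"
      by (simp only: power2_eq_iff abs_eq_iff)
    moreover have "sgn (cos h) = sgn (n / sqrt m)"
      using arg_cong[OF s, of sgn] g(1) \<open>m > 0\<close> \<open>sin h > 0\<close> by (simp add: sgn_mult)
    ultimately show ?thesis by (metis mult_sgn_abs)
  qed
  then have "h = arccos (n / sqrt m)" using h by (metis arccos_cos less_imp_le)
  then show ?thesis by (simp add: h_def half_excess_cos_def n_def m_def)
qed

lemma abs_half_excess_cos_le:
  assumes "spherical_gram x y z \<ge> 0" "\<bar>x\<bar> < 1" "\<bar>y\<bar> < 1" "\<bar>z\<bar> < 1"
  shows "\<bar>half_excess_cos x y z\<bar> \<le> 1"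
proof -
  have "2 * (1 + x) * (1 + y) * (1 + z) > 0" using assms by auto
  moreover have "(1 + x + y + z)\<^sup>2 \<le> 2 * (1 + x) * (1 + y) * (1 + z)"
    using gram_eq[of x y z] assms by linarith
  then have "\<bar>1 + x + y + z\<bar> \<le> sqrt (2 * (1 + x) * (1 + y) * (1 + z))"
    by (metis real_sqrt_abs real_sqrt_le_mono)
  ultimately show ?thesis unfolding half_excess_cos_def abs_divide
    by (metis abs_of_pos divide_le_eq_1_pos real_sqrt_gt_zero)
qed

section \<open>Hyperbolic tetrahedra of mutually tangent balls\<close>

lemma lorentz_commute: "lorentz p q = lorentz q p"
  by (simp add: lorentz_def inner_commute)

lemma lorentz_add_left: "lorentz (p + q) u = lorentz p u + lorentz q u"
  and lorentz_diff_left: "lorentz (p - q) u = lorentz p u - lorentz q u"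
  and lorentz_scaleR_left: "lorentz (c *\<^sub>R p) u = c * lorentz p u"
  by (simp_all add: lorentz_def inner_left_distrib inner_diff_left algebra_simps)

lemma lorentz_add_right: "lorentz u (p + q) = lorentz u p + lorentz u q"
  and lorentz_diff_right: "lorentz u (p - q) = lorentz u p - lorentz u q"
  and lorentz_scaleR_right: "lorentz u (c *\<^sub>R p) = c * lorentz u p"
  by (simp_all add: lorentz_def inner_right_distrib inner_diff_right algebra_simps)

lemmas lorentz_bilinear = lorentz_add_left lorentz_diff_left lorentz_scaleR_left
  lorentz_add_right lorentz_diff_right lorentz_scaleR_right

text \<open>Reversed Cauchy-Schwarz inequality. It puts \<open>- lorentz p q\<close> in the range
  where \<open>cosh\<close> undoes \<open>arcosh\<close>, so a hyperbolic distance determines the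
  Lorentz product.\<close>

lemma lorentz_le_minus_one:
  assumes "p \<in> hyperbolic_space" "q \<in> hyperbolic_space"
  shows "lorentz p q \<le> -1"
proof -
  define a b where "a = norm (snd p)" and "b = norm (snd q)"
  have fp: "(fst p)\<^sup>2 = 1 + a\<^sup>2" "fst p > 0" and fq: "(fst q)\<^sup>2 = 1 + b\<^sup>2" "fst q > 0"
    using assms by (auto simp: hyperbolic_space_def lorentz_def a_def b_def power2_eq_square
        simp flip: power2_norm_eq_inner)
  have "(1 + a * b)\<^sup>2 + (a - b)\<^sup>2 = (fst p * fst q)\<^sup>2"
    unfolding power_mult_distrib fp fq by (simp add: power2_eq_square algebra_simps)
  then have "(1 + a * b)\<^sup>2 \<le> (fst p * fst q)\<^sup>2" using zero_le_power2[of "a - b"] by linarith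
  then have "1 + a * b \<le> fst p * fst q"
    using fp fq by (meson mult_pos_pos less_imp_le power2_le_imp_le)
  moreover have "snd p \<bullet> snd q \<le> a * b"
    unfolding a_def b_def by (rule norm_cauchy_schwarz)
  ultimately show ?thesis by (simp add: lorentz_def)
qed

text \<open>Vectors orthogonal to a timelike vector are spacelike: since \<open>fst p\<close>
  exceeds the norm of \<open>snd p\<close>, Cauchy-Schwarz keeps the time component of
  \<open>n\<close> strictly below the norm of its space part.\<close>

lemma lorentz_pos_orthogonal:
  assumes p: "p \<in> hyperbolic_space" and "lorentz p n = 0" and "n \<noteq> 0"
  shows "lorentz n n > 0"
proof -
  define a where "a = norm (snd p)"
  define b where "b = norm (snd n)"
  have fp: "(fst p)\<^sup>2 = 1 + a\<^sup>2" "fst p > 0"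
    using p by (auto simp: hyperbolic_space_def lorentz_def a_def power2_eq_square
        simp flip: power2_norm_eq_inner)
  have *: "\<bar>fst p * fst n\<bar> \<le> a * b"
    using assms(2) Cauchy_Schwarz_ineq2[of "snd p" "snd n"] by (simp add: lorentz_def a_def b_def)
  have "b \<noteq> 0"
  proof
    assume "b = 0"
    then have "fst n = 0" using * fp by simp
    with \<open>b = 0\<close> show False using \<open>n \<noteq> 0\<close> by (simp add: b_def prod_eq_iff)
  qed
  then have "b\<^sup>2 > 0" by simp
  have "(fst p * fst n)\<^sup>2 \<le> (a * b)\<^sup>2"
    using * by (metis abs_ge_zero power2_abs power_mono)
  then have "(1 + a\<^sup>2) * (fst n)\<^sup>2 \<le> a\<^sup>2 * b\<^sup>2"
    by (simp add: power_mult_distrib fp)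
  then have "(1 + a\<^sup>2) * (fst n)\<^sup>2 < (1 + a\<^sup>2) * b\<^sup>2"
    using \<open>b\<^sup>2 > 0\<close> unfolding distrib_right by linarith
  then have "(fst n)\<^sup>2 < b\<^sup>2"
    by (rule mult_left_less_imp_less) simp
  then show ?thesis
    unfolding b_def power2_norm_eq_inner by (simp add: lorentz_def power2_eq_square)
qed

lemma lorentz_eq_of_hyperbolic_dist:
  assumes "p \<in> hyperbolic_space" "q \<in> hyperbolic_space" "hyperbolic_dist p q = a"
  shows "lorentz p q = - cosh a"
  using assms lorentz_le_minus_one[OF assms(1,2)]
  by (auto simp: hyperbolic_dist_def)

lemma lorentz_tangent_towards:
  assumes "p \<in> hyperbolic_space"
  shows "lorentz (tangent_towards p q) (tangent_towards p u) = lorentz q u + lorentz p q * lorentz p u"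
  using assms by (simp add: tangent_towards_def lorentz_bilinear hyperbolic_space_def
      lorentz_commute[of q p])

lemma lorentz_face_direction:
  assumes "lorentz (tangent_towards p q) (tangent_towards p q) \<noteq> 0"
  shows "lorentz (face_direction p q u) (face_direction p q v) =
    lorentz (tangent_towards p u) (tangent_towards p v)
    - lorentz (tangent_towards p q) (tangent_towards p u) *
      lorentz (tangent_towards p q) (tangent_towards p v) /
      lorentz (tangent_towards p q) (tangent_towards p q)"
  using assms by (simp add: face_direction_def Let_def lorentz_bilinear field_simps
      lorentz_commute[of "tangent_towards p u" "tangent_towards p q"]
      lorentz_commute[of "tangent_towards p v" "tangent_towards p q"])

text \<open>\<open>a\<close>, \<open>b\<close>, \<open>c\<close> are lengths of tangent vectors and
  \<open>x\<close>, \<open>y\<close>, \<open>z\<close> the cosines between them. The lengths cancel,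
  which leaves the spherical law of cosines in the link of \<open>p\<close>; \<open>z\<close>
  belongs to the side opposite the direction of \<open>q\<close>.\<close>

lemma dihedral_angle_eq:
  assumes p: "p \<in> hyperbolic_space"
    and pos: "a > 0" "b > 0" "c > 0"
    and "lorentz (tangent_towards p q) (tangent_towards p q) = a\<^sup>2"
    and "lorentz (tangent_towards p u) (tangent_towards p u) = b\<^sup>2"
    and "lorentz (tangent_towards p v) (tangent_towards p v) = c\<^sup>2"
    and "lorentz (tangent_towards p q) (tangent_towards p u) = a * b * x"
    and "lorentz (tangent_towards p q) (tangent_towards p v) = a * c * y"
    and "lorentz (tangent_towards p u) (tangent_towards p v) = b * c * z"
  shows "dihedral_angle p q u v = arccos (spherical_angle_cos z x y)"
proof -
  have nz: "lorentz (tangent_towards p q) (tangent_towards p q) \<noteq> 0" using assms by simp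
  have 1: "lorentz (face_direction p q u) (face_direction p q v) = b * c * (z - x * y)"
    and 2: "lorentz (face_direction p q u) (face_direction p q u) = b\<^sup>2 * (1 - x\<^sup>2)"
    and 3: "lorentz (face_direction p q v) (face_direction p q v) = c\<^sup>2 * (1 - y\<^sup>2)"
    unfolding lorentz_face_direction[OF nz] assms(5-) using pos
    by (simp_all add: power2_eq_square field_simps)
  have "b\<^sup>2 * (1 - x\<^sup>2) * (c\<^sup>2 * (1 - y\<^sup>2)) = (b * c)\<^sup>2 * ((1 - x\<^sup>2) * (1 - y\<^sup>2))"
    by (simp add: power2_eq_square)
  then have "sqrt (b\<^sup>2 * (1 - x\<^sup>2) * (c\<^sup>2 * (1 - y\<^sup>2))) = b * c * sqrt ((1 - x\<^sup>2) * (1 - y\<^sup>2))"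
    using pos by (simp add: real_sqrt_mult)
  then show ?thesis using pos
    by (simp add: dihedral_angle_def Let_def 1 2 3 spherical_angle_cos_def)
qed

section \<open>Face angles and realization of packed tetrahedra\<close>

text \<open>Cosine of the angle at the centre of the ball of radius \<open>r\<close> in the
  hyperbolic triangle formed by the centres of three mutually tangent balls.\<close>

definition face_cos :: "real \<Rightarrow> real \<Rightarrow> real \<Rightarrow> real" where
  "face_cos r s t = 1 - 2 * sinh s * sinh t / (sinh (r + s) * sinh (r + t))"

lemma face_cos_bounds:
  assumes "r > 0" "s > 0" "t > 0"
  shows "- 1 < face_cos r s t" "face_cos r s t < 1" "(face_cos r s t)\<^sup>2 < 1"
proof -
  have p: "sinh s > 0" "sinh t > 0" "sinh (r + s) > sinh s" "sinh (r + t) > sinh t"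
    using assms by simp_all
  then have "sinh s * sinh t < sinh (r + s) * sinh (r + t)"
    by (intro mult_strict_mono) auto
  moreover have "sinh (r + s) * sinh (r + t) > 0" using p by (intro mult_pos_pos) auto
  ultimately show "- 1 < face_cos r s t" "face_cos r s t < 1"
    using p by (simp_all add: face_cos_def field_simps)
  then show "(face_cos r s t)\<^sup>2 < 1" by (simp add: abs_square_less_1 abs_less_iff)
qed

text \<open>Hyperbolic law of cosines for the sides \<open>r + s\<close>, \<open>r + t\<close>,
  \<open>s + t\<close>; it comes from expanding \<open>cosh (s - t)\<close> in two ways.\<close>

lemma sinh_mult_face_cos:
  assumes "r > 0" "s > 0" "t > 0"
  shows "sinh (r + s) * sinh (r + t) * face_cos r s t = cosh (r + s) * cosh (r + t) - cosh (s + t)"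
proof -
  have p: "sinh (r + s) > 0" "sinh (r + t) > 0" using assms by simp_all
  have "cosh (r + s) * cosh (r + t) - sinh (r + s) * sinh (r + t) = cosh ((r + s) - (r + t))"
    by (simp only: cosh_diff)
  also have "\<dots> = cosh s * cosh t - sinh s * sinh t" by (simp add: cosh_diff)
  finally have "cosh (r + s) * cosh (r + t) - cosh (s + t) =
      sinh (r + s) * sinh (r + t) - 2 * (sinh s * sinh t)"
    unfolding cosh_add[of s t] by linarith
  also have "\<dots> = sinh (r + s) * sinh (r + t) * face_cos r s t"
    using p by (simp add: face_cos_def right_diff_distrib)
  finally show ?thesis by simp
qed

context
  fixes ri rj rk rl :: real
  assumes pos: "ri > 0" "rj > 0" "rk > 0" "rl > 0"
begin


text \<open>The distances fix all Lorentz products of the four points; the law of cosines then turns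
  them into the lengths and angles of the edge directions at \<open>p\<close>.\<close>

lemma packed_tangent_products:
  assumes "packed_tetrahedron ri rj rk rl p q u v"
  shows "lorentz (tangent_towards p q) (tangent_towards p q) = (sinh (ri + rj))\<^sup>2"
    "lorentz (tangent_towards p u) (tangent_towards p u) = (sinh (ri + rk))\<^sup>2"
    "lorentz (tangent_towards p v) (tangent_towards p v) = (sinh (ri + rl))\<^sup>2"
    "lorentz (tangent_towards p q) (tangent_towards p u) =
          sinh (ri + rj) * sinh (ri + rk) * face_cos ri rj rk"
    "lorentz (tangent_towards p q) (tangent_towards p v) =
          sinh (ri + rj) * sinh (ri + rl) * face_cos ri rj rl"
    "lorentz (tangent_towards p u) (tangent_towards p v) =
          sinh (ri + rk) * sinh (ri + rl) * face_cos ri rk rl"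
proof -
  have hyp: "p \<in> hyperbolic_space" "q \<in> hyperbolic_space" "u \<in> hyperbolic_space" "v \<in> hyperbolic_space"
    using assms by (auto simp: packed_tetrahedron_def)
  have unit: "lorentz q q = -1" "lorentz u u = -1" "lorentz v v = -1"
    using hyp by (auto simp: hyperbolic_space_def)
  have prod: "lorentz p q = - cosh (ri + rj)" "lorentz p u = - cosh (ri + rk)"
    "lorentz p v = - cosh (ri + rl)" "lorentz q u = - cosh (rj + rk)"
    "lorentz q v = - cosh (rj + rl)" "lorentz u v = - cosh (rk + rl)"
    using assms hyp by (auto simp: packed_tetrahedron_def intro!: lorentz_eq_of_hyperbolic_dist)
  show "lorentz (tangent_towards p q) (tangent_towards p q) = (sinh (ri + rj))\<^sup>2"
    "lorentz (tangent_towards p u) (tangent_towards p u) = (sinh (ri + rk))\<^sup>2"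
    "lorentz (tangent_towards p v) (tangent_towards p v) = (sinh (ri + rl))\<^sup>2"
    "lorentz (tangent_towards p q) (tangent_towards p u) =
          sinh (ri + rj) * sinh (ri + rk) * face_cos ri rj rk"
    "lorentz (tangent_towards p q) (tangent_towards p v) =
          sinh (ri + rj) * sinh (ri + rl) * face_cos ri rj rl"
    "lorentz (tangent_towards p u) (tangent_towards p v) =
          sinh (ri + rk) * sinh (ri + rl) * face_cos ri rk rl"
    using pos by (simp_all add: lorentz_tangent_towards[OF hyp(1)] unit prod sinh_mult_face_cos
        sinh_square_eq flip: power2_eq_square)
qed

text \<open>The vector \<open>n\<close> below is formed with the cofactors of the last row of the Gram matrix of the
  unit tangent vectors at \<open>p\<close>; hence \<open>n\<close> is orthogonal to the first two of them, and its own square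
  is the Gram determinant times the leading \<open>2\<times>2\<close> minor.\<close>

lemma packed_gram_pos:
  assumes packed: "packed_tetrahedron ri rj rk rl p q u v"
  shows "spherical_gram (face_cos ri rj rk) (face_cos ri rj rl) (face_cos ri rk rl) > 0"
proof -
  let ?x = "face_cos ri rj rk" and ?y = "face_cos ri rj rl" and ?z = "face_cos ri rk rl"
  define a b c where "a = sinh (ri + rj)" and "b = sinh (ri + rk)" and "c = sinh (ri + rl)"
  have abc: "a > 0" "b > 0" "c > 0" using pos by (simp_all add: a_def b_def c_def)
  note prods = packed_tangent_products[OF packed, folded a_def b_def c_def]
  define c3 where "c3 = 1 - ?x\<^sup>2"
  have c3: "c3 > 0" using face_cos_bounds(3)[of ri rj rk] pos by (simp add: c3_def)
  define c1 c2 where "c1 = ?x * ?z - ?y" and "c2 = ?x * ?y - ?z"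
  define eq eu ev where "eq = tangent_towards p q" and "eu = tangent_towards p u"
    and "ev = tangent_towards p v"
  define n where "n = (c1 / a) *\<^sub>R eq + (c2 / b) *\<^sub>R eu + (c3 / c) *\<^sub>R ev"
  have hyp: "p \<in> hyperbolic_space"
    using packed by (auto simp: packed_tetrahedron_def)
  have "lorentz p (tangent_towards p w) = 0" for w
    using hyp by (simp add: tangent_towards_def lorentz_bilinear hyperbolic_space_def)
  then have orth: "lorentz p n = 0"
    by (simp add: n_def eq_def eu_def ev_def lorentz_bilinear)
  \<comment> \<open>The coefficient of \<open>ev\<close> is positive, so \<open>n = 0\<close> would
    put \<open>v\<close> into the span of \<open>p\<close>, \<open>q\<close>, \<open>u\<close>,
    against non-degeneracy.\<close>
  have "n \<noteq> 0"
  proof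
    assume "n = 0"
    then have "(c3 / c) *\<^sub>R ev + ((c1 / a) *\<^sub>R eq + (c2 / b) *\<^sub>R eu) = 0"
      by (simp add: n_def add.commute)
    then have "(c3 / c) *\<^sub>R ev = - ((c1 / a) *\<^sub>R eq + (c2 / b) *\<^sub>R eu)"
      by (simp only: eq_neg_iff_add_eq_0)
    then have "(c / c3) *\<^sub>R (c3 / c) *\<^sub>R ev = (c / c3) *\<^sub>R - ((c1 / a) *\<^sub>R eq + (c2 / b) *\<^sub>R eu)"
      by simp
    then have "v = (c / c3) *\<^sub>R - ((c1 / a) *\<^sub>R eq + (c2 / b) *\<^sub>R eu) - lorentz p v *\<^sub>R p"
      using abc c3 by (simp add: ev_def tangent_towards_def eq_diff_eq)
    moreover have "\<dots> \<in> span {p, q, u}"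
      unfolding eq_def eu_def tangent_towards_def
      by (intro span_diff span_scale span_neg span_add span_base) auto
    moreover have "{p, q, u, v} - {v} = {p, q, u}"
      using packed by (auto simp: packed_tetrahedron_def)
    moreover have "independent {p, q, u, v}"
      using packed by (auto simp: packed_tetrahedron_def)
    ultimately show False by (metis dependent_def insertCI)
  qed
  have sym: "lorentz eu eq = lorentz eq eu" "lorentz ev eq = lorentz eq ev" "lorentz ev eu = lorentz eu ev"
    by (rule lorentz_commute)+
  note prods' = prods[folded eq_def eu_def ev_def]
  have "lorentz n eq = a * (c1 + c2 * ?x + c3 * ?y)"
    using abc by (simp add: n_def lorentz_bilinear sym prods' power2_eq_square algebra_simps)
  also have "\<dots> = 0" by (simp add: c1_def c2_def c3_def power2_eq_square algebra_simps)
  finally have 1: "lorentz n eq = 0" .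
  have "lorentz n eu = b * (c1 * ?x + c2 + c3 * ?z)"
    using abc by (simp add: n_def lorentz_bilinear sym prods' power2_eq_square algebra_simps)
  also have "\<dots> = 0" by (simp add: c1_def c2_def c3_def power2_eq_square algebra_simps)
  finally have 2: "lorentz n eu = 0" .
  have "lorentz n ev = c * (c1 * ?y + c2 * ?z + c3)"
    using abc by (simp add: n_def lorentz_bilinear sym prods' power2_eq_square algebra_simps)
  also have "\<dots> = c * spherical_gram ?x ?y ?z"
    by (simp add: c1_def c2_def c3_def spherical_gram_def power2_eq_square algebra_simps)
  finally have 3: "lorentz n ev = c * spherical_gram ?x ?y ?z" .
  have "lorentz n n = (c1 / a) * lorentz n eq + (c2 / b) * lorentz n eu + (c3 / c) * lorentz n ev"
    by (subst (2) n_def) (simp add: lorentz_bilinear)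
  also have "\<dots> = c3 * spherical_gram ?x ?y ?z" using abc by (simp add: 1 2 3)
  finally show ?thesis
    using lorentz_pos_orthogonal[OF hyp orth \<open>n \<noteq> 0\<close>] c3 by (simp add: zero_less_mult_iff)
qed

text \<open>The right side involves the radii only, which makes the description in
  \<open>solid_angle\<close> unambiguous.\<close>

lemma packed_solid_angle:
  assumes "packed_tetrahedron ri rj rk rl p q u v"
  shows "dihedral_angle p q u v + dihedral_angle p u q v + dihedral_angle p v q u - pi =
    spherical_excess (face_cos ri rj rk) (face_cos ri rj rl) (face_cos ri rk rl)"
proof -
  have hyp: "p \<in> hyperbolic_space" using assms by (auto simp: packed_tetrahedron_def)
  have abc: "sinh (ri + rj) > 0" "sinh (ri + rk) > 0" "sinh (ri + rl) > 0" using pos by simp_all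
  note prods = packed_tangent_products[OF assms]
  have "dihedral_angle p q u v =
        arccos (spherical_angle_cos (face_cos ri rk rl) (face_cos ri rj rk) (face_cos ri rj rl))"
    by (rule dihedral_angle_eq[OF hyp abc]) (fact prods)+
  moreover have "dihedral_angle p u q v =
        arccos (spherical_angle_cos (face_cos ri rj rl) (face_cos ri rj rk) (face_cos ri rk rl))"
    by (rule dihedral_angle_eq[OF hyp abc(2,1,3)])
      (simp_all add: prods lorentz_commute[of "tangent_towards p u" "tangent_towards p q"])
  moreover have "dihedral_angle p v q u =
        arccos (spherical_angle_cos (face_cos ri rj rk) (face_cos ri rj rl) (face_cos ri rk rl))"
    by (rule dihedral_angle_eq[OF hyp abc(3,1,2)])
      (simp_all add: prods lorentz_commute[of "tangent_towards p v" "tangent_towards p q"]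
        lorentz_commute[of "tangent_towards p v" "tangent_towards p u"])
  ultimately show ?thesis by (simp add: spherical_excess_def)
qed

text \<open>Put \<open>p\<close> at the base point and \<open>q\<close>, \<open>u\<close>,
  \<open>v\<close> in the directions (1, 0, 0), (x, s, 0), (y, h, k). This is the Cholesky
  factorization of the Gram matrix; its last pivot \<open>k\<close> is positive because the
  determinant is.\<close>

lemma gram_pos_imp_packed:
  assumes G: "spherical_gram (face_cos ri rj rk) (face_cos ri rj rl) (face_cos ri rk rl) > 0"
  shows "\<exists>p q u v. packed_tetrahedron ri rj rk rl p q u v"
proof -
  define x y z where "x = face_cos ri rj rk" and "y = face_cos ri rj rl" and "z = face_cos ri rk rl"
  define a b c where "a = ri + rj" and "b = ri + rk" and "c = ri + rl"
  have abc: "sinh a > 0" "sinh b > 0" "sinh c > 0" using pos by (simp_all add: a_def b_def c_def)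
  define s where "s = sqrt (1 - x\<^sup>2)"
  have "x\<^sup>2 < 1" using face_cos_bounds(3) pos by (simp add: x_def)
  then have s: "s > 0" "s\<^sup>2 = 1 - x\<^sup>2" by (simp_all add: s_def)
  define g where "g = sqrt (spherical_gram x y z)"
  have g: "g > 0" "g\<^sup>2 = spherical_gram x y z" using G by (simp_all add: g_def x_def y_def z_def)
  define h k where "h = (z - x * y) / s" and "k = g / s"
  have k: "k > 0" using g s by (simp add: k_def)
  have xh: "x * y + s * h = z" using s by (simp add: h_def)
  have "s\<^sup>2 * (y\<^sup>2 + h\<^sup>2 + k\<^sup>2) = s\<^sup>2 * y\<^sup>2 + (z - x * y)\<^sup>2 + g\<^sup>2"
    using s(1) by (simp add: h_def k_def power_divide distrib_left)
  also have "\<dots> = s\<^sup>2 * 1"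
    unfolding s g spherical_gram_def by (simp add: power2_eq_square algebra_simps)
  finally have yhk: "y\<^sup>2 + h\<^sup>2 + k\<^sup>2 = 1" using s(1) by simp
  define p q u v :: minkowski where "p = (1, 0)" and "q = (cosh a, vector [sinh a, 0, 0])"
    and "u = (cosh b, vector [sinh b * x, sinh b * s, 0])"
    and "v = (cosh c, vector [sinh c * y, sinh c * h, sinh c * k])"
  note defs = p_def q_def u_def v_def
  have inner: "vector [x1, x2, x3] \<bullet> (vector [y1, y2, y3] :: real^3) = x1 * y1 + x2 * y2 + x3 * y3"
    for x1 x2 x3 y1 y2 y3 :: real
    by (simp add: inner_vec_def sum_3)
  have "lorentz u u = (sinh b)\<^sup>2 * (x\<^sup>2 + s\<^sup>2) - (cosh b)\<^sup>2"
    "lorentz v v = (sinh c)\<^sup>2 * (y\<^sup>2 + h\<^sup>2 + k\<^sup>2) - (cosh c)\<^sup>2"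
    by (simp_all add: defs lorentz_def inner power2_eq_square algebra_simps)
  then have hyp: "{p, q, u, v} \<subseteq> hyperbolic_space"
    by (auto simp: hyperbolic_space_def yhk s(2) sinh_square_eq)
      (auto simp: defs lorentz_def inner cosh_square_eq simp flip: power2_eq_square)
  have dist: "hyperbolic_dist P R = t" if "lorentz P R = - cosh t" "t \<ge> 0" for P R t
    using that by (simp add: hyperbolic_dist_def arcosh_cosh_real)
  have "lorentz q u = sinh a * sinh b * x - cosh a * cosh b"
    by (simp add: defs lorentz_def inner)
  moreover have "lorentz q v = sinh a * sinh c * y - cosh a * cosh c"
    by (simp add: defs lorentz_def inner)
  moreover have "lorentz u v = sinh b * sinh c * z - cosh b * cosh c"
    unfolding xh[symmetric] by (simp add: defs lorentz_def inner algebra_simps)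
  ultimately have prods: "lorentz q u = - cosh (rj + rk)" "lorentz q v = - cosh (rj + rl)"
     "lorentz u v = - cosh (rk + rl)"
    using pos by (simp_all add: sinh_mult_face_cos x_def y_def z_def a_def b_def c_def)
  have prods': "lorentz p q = - cosh a" "lorentz p u = - cosh b" "lorentz p v = - cosh c"
    by (simp_all add: defs lorentz_def)
  \<comment> \<open>The coordinates are triangular, so the coefficients vanish one after another,
    starting with that of \<open>v\<close>.\<close>
  have indep: "c0 = 0 \<and> c1 = 0 \<and> c2 = 0 \<and> c3 = 0"
    if *: "c0 *\<^sub>R p + c1 *\<^sub>R q + c2 *\<^sub>R u + c3 *\<^sub>R v = 0" for c0 c1 c2 c3
  proof -
    have fst: "c0 + c1 * cosh a + c2 * cosh b + c3 * cosh c = 0"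
      using arg_cong[OF *, of fst] by (simp add: defs)
    have snd: "(c0 *\<^sub>R snd p + c1 *\<^sub>R snd q + c2 *\<^sub>R snd u + c3 *\<^sub>R snd v) $ i = 0" for i
      using arg_cong[OF *, of snd] by simp
    have "c3 = 0" using snd[of 3] abc k by (simp add: defs)
    moreover from this have "c2 = 0" using snd[of 2] abc s by (simp add: defs)
    moreover from calculation have "c1 = 0" using snd[of 1] abc by (simp add: defs)
    ultimately show ?thesis using fst by simp
  qed
  have dist': "p \<noteq> q \<and> p \<noteq> u \<and> p \<noteq> v \<and> q \<noteq> u \<and> q \<noteq> v \<and> u \<noteq> v"
    using indep[of 1 "-1" 0 0] indep[of 1 0 "-1" 0] indep[of 1 0 0 "-1"] indep[of 0 1 "-1" 0]
      indep[of 0 1 0 "-1"] indep[of 0 0 1 "-1"] by auto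
  have "independent {p, q, u, v}"
  proof
    assume "dependent {p, q, u, v}"
    then obtain f where f: "\<exists>w\<in>{p, q, u, v}. f w \<noteq> 0" "(\<Sum>w\<in>{p, q, u, v}. f w *\<^sub>R w) = 0"
      using dependent_finite[of "{p, q, u, v}"] by auto
    from f(2) dist' have "f p *\<^sub>R p + f q *\<^sub>R q + f u *\<^sub>R u + f v *\<^sub>R v = 0"
      by (simp add: add.assoc)
    from indep[OF this] f(1) show False by auto
  qed
  then have "packed_tetrahedron ri rj rk rl p q u v"
    using hyp dist' pos unfolding packed_tetrahedron_def
    by (auto simp: prods prods' a_def b_def c_def intro!: dist)
  then show ?thesis by blast
qed

lemma real_tetrahedron_iff: "real_tetrahedron ri rj rk rl \<longleftrightarrow>
      spherical_gram (face_cos ri rj rk) (face_cos ri rj rl) (face_cos ri rk rl) > 0"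
  unfolding real_tetrahedron_def using packed_gram_pos gram_pos_imp_packed by blast

lemma solid_angle_eq_excess:
  assumes "spherical_gram (face_cos ri rj rk) (face_cos ri rj rl) (face_cos ri rk rl) > 0"
  shows "solid_angle ri rj rk rl =
        spherical_excess (face_cos ri rj rk) (face_cos ri rj rl) (face_cos ri rk rl)"
proof -
  obtain p q u v where *: "packed_tetrahedron ri rj rk rl p q u v"
    using gram_pos_imp_packed[OF assms] by blast
  show ?thesis unfolding solid_angle_def
  proof (rule the_equality)
    show "\<exists>p q u v. packed_tetrahedron ri rj rk rl p q u v \<and>
          spherical_excess (face_cos ri rj rk) (face_cos ri rj rl) (face_cos ri rk rl) =
      dihedral_angle p q u v + dihedral_angle p u q v + dihedral_angle p v q u - pi"
      using * packed_solid_angle[OF *] by metis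
  qed (auto simp: packed_solid_angle)
qed

end

section \<open>Comparison with the regular tetrahedron\<close>

lemma coth_eq_inverse_tanh: "coth r = inverse (tanh r)"
  by (simp add: coth_def tanh_def)

lemma coth_gt_1: "r > 0 \<Longrightarrow> coth r > 1"
  using tanh_real_lt_1[of r] by (simp add: coth_eq_inverse_tanh one_less_inverse)

lemma coth_antimono: "0 < r \<Longrightarrow> r \<le> s \<Longrightarrow> coth s \<le> coth r"
  by (simp add: coth_eq_inverse_tanh le_imp_inverse_le)

text \<open>Uses \<open>sinh (r + s) = sinh r * sinh s * (coth r + coth s)\<close>. The three face
  cosines at one vertex thus have the form \<open>1 - 2 * h / (A * B)\<close> with a common
  \<open>h\<close>.\<close>

lemma face_cos_eq_coth:
  assumes "r > 0" "s > 0" "t > 0"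
  shows "face_cos r s t = 1 - 2 * ((coth r)\<^sup>2 - 1) / ((coth r + coth s) * (coth r + coth t))"
proof -
  have p: "sinh r > 0" "sinh s > 0" "sinh t > 0" "sinh (r + s) > 0" "sinh (r + t) > 0"
    using assms by simp_all
  have add: "sinh (r + q) = sinh r * sinh q * (coth r + coth q)" if "q > 0" for q
    using that p by (simp add: coth_def sinh_add field_simps)
  have "(coth r)\<^sup>2 - 1 = 1 / (sinh r)\<^sup>2"
    using p by (simp add: coth_def power_divide cosh_square_eq field_simps)
  then have "2 * ((coth r)\<^sup>2 - 1) / ((coth r + coth s) * (coth r + coth t)) =
    2 * sinh s * sinh t / (sinh (r + s) * sinh (r + t))"
    using p assms by (simp add: add power2_eq_square)
  then show ?thesis by (simp add: face_cos_def)
qed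

section \<open>The excess in cotangent coordinates\<close>

text \<open>This is \<open>gram_eq\<close> for cosines of the form
  \<open>1 - 2 * h / (A * B)\<close>, with denominators cleared.\<close>

lemma gram_identity:
  "4 * ((A * B - h) * (A * C - h) * (B * C - h)) = (2 * A * B * C - h * (A + B + C))\<^sup>2
    + h\<^sup>2 * (4 * (A * B + A * C + B * C) - (A + B + C)\<^sup>2 - 4 * h)" for h :: real
  by (simp add: power2_eq_square algebra_simps)

context
  fixes A B C h :: real
  assumes ABC: "A > 0" "B > 0" "C > 0"
begin

lemma one_plus_sum_edge_cos:
  "1 + (1 - 2 * h / (A * B)) + (1 - 2 * h / (A * C)) + (1 - 2 * h / (B * C)) =
    2 * (2 * A * B * C - h * (A + B + C)) / (A * B * C)"
  using ABC by (simp add: field_simps)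

lemma prod_one_plus_edge_cos:
  "2 * (1 + (1 - 2 * h / (A * B))) * (1 + (1 - 2 * h / (A * C))) * (1 + (1 - 2 * h / (B * C))) =
    16 * ((A * B - h) * (A * C - h) * (B * C - h)) / (A * B * C)\<^sup>2"
proof -
  have "1 + (1 - 2 * h / (a * b)) = 2 * (a * b - h) / (a * b)" if "a > 0" "b > 0" for a b
    using that by (simp add: field_simps)
  then show ?thesis using ABC by (simp add: power2_eq_square field_simps)
qed

lemma spherical_gram_edge_cos:
  "spherical_gram (1 - 2 * h / (A * B)) (1 - 2 * h / (A * C)) (1 - 2 * h / (B * C)) =
    4 * h\<^sup>2 * (4 * (A * B + A * C + B * C) - (A + B + C)\<^sup>2 - 4 * h) / (A * B * C)\<^sup>2"
proof -
  define N D where "N = 2 * A * B * C - h * (A + B + C)" and "D = A * B * C"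
  have "spherical_gram (1 - 2 * h / (A * B)) (1 - 2 * h / (A * C)) (1 - 2 * h / (B * C)) =
     16 * ((A * B - h) * (A * C - h) * (B * C - h)) / D\<^sup>2 - (2 * N / D)\<^sup>2"
    using gram_eq[of "1 - 2 * h / (A * B)" "1 - 2 * h / (A * C)" "1 - 2 * h / (B * C)"]
    unfolding one_plus_sum_edge_cos prod_one_plus_edge_cos N_def D_def by linarith
  also have "\<dots> = (4 * (4 * ((A * B - h) * (A * C - h) * (B * C - h))) - 4 * N\<^sup>2) / D\<^sup>2"
    by (simp add: power_divide power_mult_distrib diff_divide_distrib)
  finally show ?thesis unfolding gram_identity N_def[symmetric] D_def[symmetric] by simp
qed

lemma half_excess_cos_edge_cos:
  "half_excess_cos (1 - 2 * h / (A * B)) (1 - 2 * h / (A * C)) (1 - 2 * h / (B * C)) =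
    (2 * A * B * C - h * (A + B + C)) / (2 * sqrt ((A * B - h) * (A * C - h) * (B * C - h)))"
proof -
  define P where "P = (A * B - h) * (A * C - h) * (B * C - h)"
  define N D where "N = 2 * A * B * C - h * (A + B + C)" and "D = A * B * C"
  have "D > 0" using ABC by (simp add: D_def)
  then have "sqrt (16 * P / D\<^sup>2) = 4 * sqrt P / D"
    using real_sqrt_abs[of 4] by (simp add: real_sqrt_divide real_sqrt_mult)
  then show ?thesis
    unfolding half_excess_cos_def one_plus_sum_edge_cos prod_one_plus_edge_cos
      P_def[symmetric] N_def[symmetric] D_def[symmetric]
    using \<open>D > 0\<close> by simp
qed

end

text \<open>Up to positive factors, the derivative in the first variable is
  \<open>x * (B + C) - (B - C)\<^sup>2 - 2 * h\<close>. This increases with \<open>x\<close> and is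
  nonnegative at the left end by \<open>nn\<close>.\<close>

lemma half_excess_cos_edge_mono:
  fixes h :: real
  assumes "0 < A" "A \<le> A'" and BC: "0 < B" "0 < C" and h: "0 < h" "h < A * B" "h < A * C" "h < B * C"
    and nn: "(B - C)\<^sup>2 + 2 * h \<le> A * (B + C)"
  shows "(2 * A * B * C - h * (A + B + C)) / (2 * sqrt ((A * B - h) * (A * C - h) * (B * C - h)))
    \<le> (2 * A' * B * C - h * (A' + B + C)) / (2 * sqrt ((A' * B - h) * (A' * C - h) * (B * C - h)))"
    (is "?f A \<le> ?f A'")
proof (rule DERIV_nonneg_imp_nondecreasing[OF \<open>A \<le> A'\<close>])
  fix x assume x: "A \<le> x" "x \<le> A'"
  define R N where "R = (x * B - h) * (x * C - h) * (B * C - h)"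
    and "N = 2 * x * B * C - h * (x + B + C)"
  define R' N' where "R' = (B * (x * C - h) + C * (x * B - h)) * (B * C - h)"
    and "N' = 2 * B * C - h"
  have "h < x * B" "h < x * C"
    using x h BC by (meson less_le_trans mult_right_mono less_imp_le)+
  then have R: "R > 0" using h by (simp add: R_def)
  have dN: "((\<lambda>x. 2 * x * B * C - h * (x + B + C)) has_real_derivative N') (at x)"
    unfolding N'_def by (auto intro!: derivative_eq_intros)
  have dR: "((\<lambda>x. (x * B - h) * (x * C - h) * (B * C - h)) has_real_derivative R') (at x)"
    unfolding R'_def by (auto intro!: derivative_eq_intros simp: algebra_simps)
  define G where "G = inverse (sqrt R)"
  have "((\<lambda>x. sqrt ((x * B - h) * (x * C - h) * (B * C - h))) has_real_derivative G / 2 * R') (at x)"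
    using DERIV_chain2[OF DERIV_real_sqrt dR] R by (simp add: R_def G_def)
  from DERIV_divide[OF dN DERIV_cmult[OF this, of 2]]
  have der: "(?f
      has_real_derivative (N' * (2 * sqrt R) - N * (2 * (G / 2 * R'))) / (2 * sqrt R * (2 * sqrt R))) (at x)"
    using R by (simp add: R_def[symmetric] N_def[symmetric])
  have "R * G = sqrt R"
    using R by (simp add: G_def real_div_sqrt flip: divide_inverse)
  then have "N' * (2 * sqrt R) - N * (2 * (G / 2 * R')) = (2 * N' * R - N * R') * G"
    by (simp add: left_diff_distrib mult.assoc)
  also have "2 * N' * R - N * R' = (B * C - h) * h\<^sup>2 * (x * (B + C) - (B - C)\<^sup>2 - 2 * h)"
    unfolding N'_def N_def R'_def R_def by (simp add: power2_eq_square algebra_simps)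
  also have "\<dots> * G \<ge> 0"
  proof -
    have "A * (B + C) \<le> x * (B + C)" using x BC by (intro mult_right_mono) auto
    then have "x * (B + C) - (B - C)\<^sup>2 - 2 * h \<ge> 0" using nn by linarith
    then show ?thesis using R h by (simp add: G_def)
  qed
  finally have "(N' * (2 * sqrt R) - N * (2 * (G / 2 * R'))) / (2 * sqrt R * (2 * sqrt R)) \<ge> 0"
    using R by (intro divide_nonneg_nonneg) auto
  with der show "\<exists>y. (?f has_real_derivative y) (at x) \<and> 0 \<le> y" by blast
qed

definition coth_excess_cos :: "real \<Rightarrow> real \<Rightarrow> real \<Rightarrow> real \<Rightarrow> real" where
  "coth_excess_cos w a b c =
     half_excess_cos (1 - 2 * (w\<^sup>2 - 1) / ((w + a) * (w + b)))
       (1 - 2 * (w\<^sup>2 - 1) / ((w + a) * (w + c))) (1 - 2 * (w\<^sup>2 - 1) / ((w + b) * (w + c)))"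

lemma half_excess_cos_commute:
  "half_excess_cos x y z = half_excess_cos y x z" "half_excess_cos x y z = half_excess_cos x z y"
  by (simp_all only: half_excess_cos_def mult_ac add_ac)

lemma coth_excess_cos_commute:
  "coth_excess_cos w a b c = coth_excess_cos w b a c" "coth_excess_cos w a b c = coth_excess_cos w a c b"
  unfolding coth_excess_cos_def
  by (metis half_excess_cos_commute mult.commute)+

text \<open>With \<open>A = w + a\<close> and so on, condition \<open>nn\<close> of
  \<open>half_excess_cos_edge_mono\<close> follows from
  \<open>(b - c)\<^sup>2 \<le> w * (b + c)\<close>, which holds because neither \<open>b\<close> nor
  \<open>c\<close> exceeds \<open>w\<close>.\<close>

lemma coth_excess_cos_mono:
  assumes "1 < a" "a \<le> a'" "a' \<le> w" and b: "1 < b" "b \<le> w" and c: "1 < c" "c \<le> w"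
  shows "coth_excess_cos w a b c \<le> coth_excess_cos w a' b c"
proof -
  have w: "w > 1" using assms by linarith
  have pos: "w + a > 0" "w + a' > 0" "w + b > 0" "w + c > 0" using assms by linarith+
  have h: "w\<^sup>2 - 1 < (w + p) * (w + q)" if "p > 0" "q > 0" for p q
  proof -
    have "w * q + p * w + p * q > 0" using that w by (intro add_pos_pos mult_pos_pos) auto
    then show ?thesis by (simp add: power2_eq_square algebra_simps)
  qed
  have "(b - c)\<^sup>2 \<le> w * (b + c)"
  proof -
    have "(b - c)\<^sup>2 \<le> (max b c)\<^sup>2" using b c by (intro abs_le_square_iff[THEN iffD1]) auto
    also have "\<dots> = max b c * max b c" by (simp add: power2_eq_square)
    also have "\<dots> \<le> w * (b + c)" using b c by (intro mult_mono) auto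
    finally show ?thesis .
  qed
  moreover have "a * w \<ge> 0" "a * b \<ge> 0" "a * c \<ge> 0" using assms w by simp_all
  ultimately have nn: "((w + b) - (w + c))\<^sup>2 + 2 * (w\<^sup>2 - 1) \<le> (w + a) * ((w + b) + (w + c))"
    by (simp add: power2_eq_square algebra_simps)
  have "w\<^sup>2 > 1" using w by simp
  then show ?thesis
    unfolding coth_excess_cos_def
    unfolding half_excess_cos_edge_cos[OF pos(1,3,4)] half_excess_cos_edge_cos[OF pos(2,3,4)]
    using assms pos nn by (intro half_excess_cos_edge_mono h) auto
qed

text \<open>\<open>a\<close>, \<open>b\<close>, \<open>c\<close> are raised to \<open>w\<close> one
  at a time; no cotangent ever exceeds \<open>w\<close>, so each move is monotone.\<close>

lemma coth_excess_cos_le_regular: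
  assumes "1 < a" "a \<le> w" "1 < b" "b \<le> w" "1 < c" "c \<le> w"
  shows "coth_excess_cos w a b c \<le> coth_excess_cos w w w w"
proof -
  have w: "1 < w" using assms by linarith
  have "coth_excess_cos w a b c \<le> coth_excess_cos w w b c"
    using assms by (intro coth_excess_cos_mono) auto
  also have "\<dots> = coth_excess_cos w b w c" by (rule coth_excess_cos_commute)
  also have "\<dots> \<le> coth_excess_cos w w w c"
    using assms w by (intro coth_excess_cos_mono) auto
  also have "\<dots> = coth_excess_cos w c w w" by (metis coth_excess_cos_commute)
  also have "\<dots> \<le> coth_excess_cos w w w w"
    using assms w by (intro coth_excess_cos_mono) auto
  finally show ?thesis .
qed

section \<open>Face cosines above the regular value\<close>

text \<open>The square of \<open>half_excess_cos z z z\<close>, chosen because it is a rational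
  function with a simple derivative.\<close>

definition regular_excess_cos2 :: "real \<Rightarrow> real" where
  "regular_excess_cos2 z = (1 + 3 * z)\<^sup>2 / (2 * (1 + z) ^ 3)"

lemma half_excess_cos_regular:
  "z \<ge> 0 \<Longrightarrow> half_excess_cos z z z = sqrt (regular_excess_cos2 z)"
  by (simp add: half_excess_cos_def regular_excess_cos2_def real_sqrt_divide power3_eq_cube mult_ac)

lemma regular_excess_cos2_deriv:
  assumes "z \<ge> 0"
  shows "(regular_excess_cos2 has_real_derivative 6 * (1 + 3 * z) * (1 - z) / (4 * (1 + z) ^ 4)) (at z)"
proof -
  define p where "p = 1 + z"
  have p: "p > 0" using assms by (simp add: p_def)
  have "(regular_excess_cos2 has_real_derivative
      (6 * (1 + 3 * z) * (2 * p ^ 3) - (1 + 3 * z)\<^sup>2 * (6 * p\<^sup>2)) / (2 * p ^ 3 * (2 * p ^ 3))) (at z)"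
    using p unfolding regular_excess_cos2_def[abs_def] p_def
    by (auto intro!: derivative_eq_intros)
  moreover have "6 * (1 + 3 * z) * (2 * p ^ 3) - (1 + 3 * z)\<^sup>2 * (6 * p\<^sup>2) =
      p\<^sup>2 * (6 * (1 + 3 * z) * (1 - z))"
    by (simp add: p_def power2_eq_square power3_eq_cube algebra_simps)
  moreover have "2 * p ^ 3 * (2 * p ^ 3) = p\<^sup>2 * (4 * p ^ 4)"
    by (simp add: power_numeral_reduce)
  ultimately show ?thesis using p unfolding p_def[symmetric] by simp
qed

lemma regular_excess_cos2_mono:
  assumes "0 \<le> x" "x \<le> y" "y \<le> 1"
  shows "regular_excess_cos2 x \<le> regular_excess_cos2 y"
proof (rule DERIV_nonneg_imp_nondecreasing[OF \<open>x \<le> y\<close>])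
  fix z assume "x \<le> z" "z \<le> y"
  then have "0 \<le> z" "z \<le> 1" using assms by auto
  then show "\<exists>D. (regular_excess_cos2 has_real_derivative D) (at z) \<and> 0 \<le> D"
    using regular_excess_cos2_deriv[of z] by (auto intro!: exI divide_nonneg_pos mult_nonneg_nonneg)
qed

text \<open>The comparison passes from (z, z, z) to (y, y, z) and then to (x, y, z); each time the
  difference factors into nonnegative terms. \<open>u\<close> is the numerator of the middle
  triple.\<close>

lemma sorted_excess_ratio_ge:
  fixes x y z :: real
  assumes "0 \<le> z" "z \<le> y" "y \<le> x" "x \<le> 1"
  shows "regular_excess_cos2 z \<le> (1 + x + y + z)\<^sup>2 / (2 * (1 + x) * (1 + y) * (1 + z))"
proof -
  define u where "u = 1 + 2 * y + z"
  have pos: "1 + x > 0" "1 + y > 0" "1 + z > 0" "u > 0" using assms by (auto simp: u_def)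
  have "((1 + 3 * z) * (1 + y))\<^sup>2 \<le> (u * (1 + z))\<^sup>2"
  proof (rule power_mono)
    have "u * (1 + z) - (1 + 3 * z) * (1 + y) = (y - z) * (1 - z)"
      by (simp add: u_def algebra_simps)
    also have "\<dots> \<ge> 0" using assms by simp
    finally show "(1 + 3 * z) * (1 + y) \<le> u * (1 + z)" by simp
  qed (use assms in simp)
  then have "(1 + 3 * z)\<^sup>2 / (2 * (1 + z) ^ 3) \<le> u\<^sup>2 / (2 * (1 + y)\<^sup>2 * (1 + z))"
    using pos by (simp add: divide_simps power_mult_distrib)
        (simp add: power2_eq_square power3_eq_cube mult_ac)
  also have "\<dots> \<le> (1 + x + y + z)\<^sup>2 / (2 * (1 + x) * (1 + y) * (1 + z))"
  proof -
    have "(1 + x + y + z)\<^sup>2 * (1 + y) - u\<^sup>2 * (1 + x) = (x - y) * (u * (1 - z) + (x - y) * (1 + y))"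
      by (simp add: u_def power2_eq_square algebra_simps)
    also have "\<dots> \<ge> 0" using assms pos by simp
    finally have "u\<^sup>2 * (1 + x) \<le> (1 + x + y + z)\<^sup>2 * (1 + y)" by simp
    then have "u\<^sup>2 / (1 + y) \<le> (1 + x + y + z)\<^sup>2 / (1 + x)"
      using pos by (simp add: divide_simps mult_ac)
    then have "u\<^sup>2 / (1 + y) / (2 * (1 + y) * (1 + z)) \<le>
          (1 + x + y + z)\<^sup>2 / (1 + x) / (2 * (1 + y) * (1 + z))"
      using pos by (intro divide_right_mono) auto
    then show ?thesis by (simp only: power2_eq_square mult_ac divide_divide_eq_left)
  qed
  finally show ?thesis by (simp add: regular_excess_cos2_def)
qed

text \<open>By symmetry the cosines may be sorted. First \<open>m\<close> is raised to the smallest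
  of them, then the other two are restored.\<close>

lemma half_excess_cos_ge_regular:
  assumes "0 \<le> m" "m \<le> x" "m \<le> y" "m \<le> z" "x \<le> 1" "y \<le> 1" "z \<le> 1"
  shows "half_excess_cos m m m \<le> half_excess_cos x y z"
proof -
  have sorted: "half_excess_cos m m m \<le> half_excess_cos x y z"
    if "m \<le> z" "z \<le> y" "y \<le> x" "x \<le> 1" for x y z
  proof -
    have "regular_excess_cos2 m \<le> regular_excess_cos2 z"
      using that assms by (intro regular_excess_cos2_mono) auto
    also have "\<dots> \<le> (1 + x + y + z)\<^sup>2 / (2 * (1 + x) * (1 + y) * (1 + z))"
      using that assms by (intro sorted_excess_ratio_ge) auto
    finally have "sqrt (regular_excess_cos2 m) \<le> sqrt ((1 + x + y + z)\<^sup>2 / (2 * (1 + x) * (1 + y) * (1 + z)))"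
      by simp
    also have "\<dots> = half_excess_cos x y z"
      using that assms by (simp add: half_excess_cos_def real_sqrt_divide)
    finally show ?thesis using assms by (simp add: half_excess_cos_regular)
  qed
  consider "z \<le> y" "y \<le> x" | "z \<le> x" "x \<le> y" | "y \<le> z" "z \<le> x" | "y \<le> x" "x \<le> z"
    | "x \<le> z" "z \<le> y" | "x \<le> y" "y \<le> z" by linarith
  then show ?thesis
    by cases (metis sorted half_excess_cos_commute assms)+
qed

text \<open>\<open>(1 + (tanh r)\<^sup>2) / 2\<close> is the cosine of the angle of an equilateral
  hyperbolic triangle with side \<open>2 * r\<close>. The closed form makes sense for every real
  \<open>r\<close> and gives the Euclidean value at 0.\<close>

definition regular_solid_angle :: "real \<Rightarrow> real" where
  "regular_solid_angle r = 2 * arccos (sqrt (regular_excess_cos2 ((1 + (tanh r)\<^sup>2) / 2)))"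

lemma regular_excess_cos2_bounds:
  assumes "0 \<le> z" "z \<le> 1"
  shows "0 \<le> regular_excess_cos2 z" "regular_excess_cos2 z \<le> 1"
proof -
  show "0 \<le> regular_excess_cos2 z" using assms by (simp add: regular_excess_cos2_def)
  have "regular_excess_cos2 z \<le> regular_excess_cos2 1"
    using assms by (intro regular_excess_cos2_mono) auto
  then show "regular_excess_cos2 z \<le> 1" by (simp add: regular_excess_cos2_def)
qed

lemma tanh_square_bounds: "0 \<le> (tanh r)\<^sup>2" "(tanh r)\<^sup>2 < 1" for r :: real
  using tanh_real_bounds[of r] by (auto simp: abs_square_less_1 abs_less_iff)

lemma regular_solid_angle_bounds: "0 \<le> regular_solid_angle r" "regular_solid_angle r \<le> 2 * pi"
proof -
  have "regular_excess_cos2 ((1 + (tanh r)\<^sup>2) / 2) \<le> 1" "0 \<le> regular_excess_cos2 ((1 + (tanh r)\<^sup>2) / 2)"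
    using tanh_square_bounds[of r] by (intro regular_excess_cos2_bounds; simp)+
  then have "-1 \<le> sqrt (regular_excess_cos2 ((1 + (tanh r)\<^sup>2) / 2))"
    "sqrt (regular_excess_cos2 ((1 + (tanh r)\<^sup>2) / 2)) \<le> 1"
    by (auto intro: order_trans[of _ 0])
  from arccos_lbound[OF this] arccos_ubound[OF this]
  show "0 \<le> regular_solid_angle r" "regular_solid_angle r \<le> 2 * pi"
    by (simp_all add: regular_solid_angle_def)
qed

lemma coth_excess_cos_regular:
  assumes "r > 0"
  shows "coth_excess_cos (coth r) (coth r) (coth r) (coth r) =
    sqrt (regular_excess_cos2 ((1 + (tanh r)\<^sup>2) / 2))"
    and "1 - 2 * ((coth r)\<^sup>2 - 1) / ((coth r + coth r) * (coth r + coth r)) = (1 + (tanh r)\<^sup>2) / 2"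
proof -
  have "coth r > 1" using assms by (rule coth_gt_1)
  moreover have t: "tanh r = inverse (coth r)" by (simp add: coth_eq_inverse_tanh)
  ultimately show *: "1 - 2 * ((coth r)\<^sup>2 - 1) / ((coth r + coth r) * (coth r + coth r)) =
        (1 + (tanh r)\<^sup>2) / 2"
    unfolding t by (simp add: power2_eq_square field_simps)
  show "coth_excess_cos (coth r) (coth r) (coth r) (coth r) =
    sqrt (regular_excess_cos2 ((1 + (tanh r)\<^sup>2) / 2))"
    unfolding coth_excess_cos_def * by (rule half_excess_cos_regular) simp
qed

section \<open>Extended solid angles against the regular one\<close>

text \<open>Completing the square in \<open>coth ri\<close> splits the region where \<open>Q\<close>
  is not positive into two branches; \<open>in_D\<close> is the one beyond the larger root.\<close>

lemma Q_eq_quadratic: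
  "Q ri rj rk rl = 4 * (coth rj * coth rk + coth rk * coth rl + coth rl * coth rj + 1)
    - (coth ri - (coth rj + coth rk + coth rl))\<^sup>2"
  by (simp add: Q_def power2_eq_square algebra_simps)

lemma Q_commute: "Q ri rj rk rl = Q ri rk rj rl" "Q ri rj rk rl = Q ri rj rl rk"
  by (simp_all add: Q_def add_ac)

context
  fixes ri rj rk rl :: real
  assumes pos: "ri > 0" "rj > 0" "rk > 0" "rl > 0"
begin

text \<open>Cotangents exceed 1, so the factors around \<open>Q\<close> are positive and the Gram
  condition becomes positivity of \<open>Q\<close>.\<close>

lemma face_gram_eq_Q:
  "spherical_gram (face_cos ri rj rk) (face_cos ri rj rl) (face_cos ri rk rl) =
    4 * ((coth ri)\<^sup>2 - 1)\<^sup>2 * Q ri rj rk rl /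
      ((coth ri + coth rj) * (coth ri + coth rk) * (coth ri + coth rl))\<^sup>2"
proof -
  have "coth ri + coth rj > 0" "coth ri + coth rk > 0" "coth ri + coth rl > 0"
    using coth_gt_1[OF pos(1)] coth_gt_1[OF pos(2)] coth_gt_1[OF pos(3)] coth_gt_1[OF pos(4)]
    by linarith+
  from spherical_gram_edge_cos[OF this, of "(coth ri)\<^sup>2 - 1"] show ?thesis
    using pos by (simp add: face_cos_eq_coth Q_def power2_eq_square algebra_simps)
qed

lemma face_gram_pos_iff:
  "spherical_gram (face_cos ri rj rk) (face_cos ri rj rl) (face_cos ri rk rl) > 0 \<longleftrightarrow> Q ri rj rk rl > 0"
proof -
  have g: "coth ri > 1" "coth rj > 1" "coth rk > 1" "coth rl > 1" using coth_gt_1 pos by auto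
  define D where "D = ((coth ri + coth rj) * (coth ri + coth rk) * (coth ri + coth rl))\<^sup>2"
  have D: "D > 0" using g by (simp add: D_def)
  have "(coth ri)\<^sup>2 > 1" using g by simp
  then have "4 * ((coth ri)\<^sup>2 - 1)\<^sup>2 > 0" by simp
  with D show ?thesis
    unfolding face_gram_eq_Q D_def[symmetric] by (simp add: zero_less_divide_iff zero_less_mult_iff)
qed

lemma real_tetrahedron_iff_Q: "real_tetrahedron ri rj rk rl \<longleftrightarrow> Q ri rj rk rl > 0"
  using real_tetrahedron_iff[OF pos] face_gram_pos_iff by simp

lemma solid_angle_eq:
  assumes "Q ri rj rk rl > 0"
  shows "solid_angle ri rj rk rl = 2 * arccos (coth_excess_cos (coth ri) (coth rj) (coth rk) (coth rl))"
    and "\<bar>coth_excess_cos (coth ri) (coth rj) (coth rk) (coth rl)\<bar> \<le> 1"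
proof -
  have G: "spherical_gram (face_cos ri rj rk) (face_cos ri rj rl) (face_cos ri rk rl) > 0"
    using assms face_gram_pos_iff by simp
  have eq: "half_excess_cos (face_cos ri rj rk) (face_cos ri rj rl) (face_cos ri rk rl) =
    coth_excess_cos (coth ri) (coth rj) (coth rk) (coth rl)"
    using pos by (simp add: coth_excess_cos_def face_cos_eq_coth)
  show "solid_angle ri rj rk rl = 2 * arccos (coth_excess_cos (coth ri) (coth rj) (coth rk) (coth rl))"
    unfolding eq[symmetric] solid_angle_eq_excess[OF pos G]
    using pos face_cos_bounds(3) by (intro spherical_excess_eq[OF G])
  show "\<bar>coth_excess_cos (coth ri) (coth rj) (coth rk) (coth rl)\<bar> \<le> 1"
    unfolding eq[symmetric] using pos G
    by (intro abs_half_excess_cos_le) (auto simp: abs_less_iff face_cos_bounds less_imp_le minus_less_iff)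
qed

text \<open>The largest radius has the smallest cotangent, so every face cosine is at least the
  regular one. In the virtual case \<open>in_D\<close> would force \<open>coth ri\<close> above
  \<open>coth rj\<close>, so the extended angle is 0.\<close>

lemma ext_solid_angle_le_regular:
  assumes max: "rj \<le> ri" "rk \<le> ri" "rl \<le> ri"
  shows "ext_solid_angle ri rj rk rl \<le> regular_solid_angle ri"
proof (cases "Q ri rj rk rl > 0")
  case True
  define w a b c where "w = coth ri" and "a = coth rj" and "b = coth rk" and "c = coth rl"
  have w: "w > 1" "w \<le> a" "w \<le> b" "w \<le> c"
    using coth_gt_1 coth_antimono max pos by (auto simp: w_def a_def b_def c_def)
  have w2: "w\<^sup>2 - 1 \<ge> 0" using w by simp
  have m0: "0 \<le> 1 - 2 * (w\<^sup>2 - 1) / ((w + w) * (w + w))"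
    unfolding w_def coth_excess_cos_regular(2)[OF pos(1)]
    using tanh_square_bounds(1)[of ri] by simp
  have ge: "1 - 2 * (w\<^sup>2 - 1) / ((w + w) * (w + w)) \<le> 1 - 2 * (w\<^sup>2 - 1) / ((w + p) * (w + q))"
    if "w \<le> p" "w \<le> q" for p q
  proof -
    have "(w + w) * (w + w) \<le> (w + p) * (w + q)" using that w by (intro mult_mono) auto
    moreover have "0 < (w + w) * (w + w)" using w by simp
    ultimately show ?thesis using w2 by (simp add: divide_left_mono)
  qed
  have le1: "1 - 2 * (w\<^sup>2 - 1) / ((w + p) * (w + q)) \<le> 1" if "w \<le> p" "w \<le> q" for p q
  proof -
    have "0 \<le> 2 * (w\<^sup>2 - 1) / ((w + p) * (w + q))"
      using that w w2 by (intro divide_nonneg_nonneg mult_nonneg_nonneg) auto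
    then show ?thesis by simp
  qed
  have "coth_excess_cos w w w w \<le> coth_excess_cos w a b c"
    unfolding coth_excess_cos_def using w by (intro half_excess_cos_ge_regular m0 ge le1)
  then have le: "sqrt (regular_excess_cos2 ((1 + (tanh ri)\<^sup>2) / 2)) \<le> coth_excess_cos w a b c"
    using coth_excess_cos_regular(1)[OF pos(1)] by (simp add: w_def)
  have "0 \<le> sqrt (regular_excess_cos2 ((1 + (tanh ri)\<^sup>2) / 2))"
    using tanh_square_bounds[of ri] by (simp add: regular_excess_cos2_bounds)
  then have "-1 \<le> sqrt (regular_excess_cos2 ((1 + (tanh ri)\<^sup>2) / 2))" by linarith
  moreover have "coth_excess_cos w a b c \<le> 1"
    using solid_angle_eq(2)[OF True] by (simp add: w_def a_def b_def c_def)
  ultimately have "arccos (coth_excess_cos w a b c) \<le>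
        arccos (sqrt (regular_excess_cos2 ((1 + (tanh ri)\<^sup>2) / 2)))"
    using le by (intro arccos_le_arccos) auto
  then show ?thesis
    using True solid_angle_eq(1)[OF True]
    by (simp add: ext_solid_angle_def regular_solid_angle_def w_def a_def b_def c_def)
next
  case False
  have "coth rj > 1" "coth rk > 1" "coth rl > 1" "coth ri \<le> coth rj"
    using coth_gt_1 coth_antimono max pos by auto
  moreover from this have "sqrt (coth rj * coth rk + coth rk * coth rl + coth rl * coth rj + 1) \<ge> 0"
    by simp
  ultimately have "\<not> in_D ri rj rk rl" unfolding in_D_def by linarith
  with False show ?thesis by (simp add: ext_solid_angle_def regular_solid_angle_bounds)
qed

text \<open>The smallest radius has the largest cotangent \<open>w\<close>, so the real case is
  \<open>coth_excess_cos_le_regular\<close>. In the virtual case \<open>in_D\<close> must hold and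
  the extended angle is \<open>2 * pi\<close>.\<close>

lemma ext_solid_angle_ge_regular:
  assumes min: "ri \<le> rj" "ri \<le> rk" "ri \<le> rl"
  shows "regular_solid_angle ri \<le> ext_solid_angle ri rj rk rl"
proof -
  define w a b c where "w = coth ri" and "a = coth rj" and "b = coth rk" and "c = coth rl"
  have w: "1 < a" "a \<le> w" "1 < b" "b \<le> w" "1 < c" "c \<le> w"
    using coth_gt_1 coth_antimono min pos by (auto simp: w_def a_def b_def c_def)
  show ?thesis
  proof (cases "Q ri rj rk rl > 0")
    case True
    have le: "coth_excess_cos w a b c \<le> sqrt (regular_excess_cos2 ((1 + (tanh ri)\<^sup>2) / 2))"
      using coth_excess_cos_le_regular[OF w] coth_excess_cos_regular(1)[OF pos(1)] by (simp add: w_def)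
    have "sqrt (regular_excess_cos2 ((1 + (tanh ri)\<^sup>2) / 2)) \<le> 1"
      using tanh_square_bounds[of ri] by (simp add: regular_excess_cos2_bounds)
    moreover have "-1 \<le> coth_excess_cos w a b c"
      using solid_angle_eq(2)[OF True] by (simp add: w_def a_def b_def c_def)
    ultimately have "arccos (sqrt (regular_excess_cos2 ((1 + (tanh ri)\<^sup>2) / 2))) \<le>
          arccos (coth_excess_cos w a b c)"
      using le by (intro arccos_le_arccos) auto
    then show ?thesis
      using True solid_angle_eq(1)[OF True]
      by (simp add: ext_solid_angle_def regular_solid_angle_def w_def a_def b_def c_def)
  next
    case False
    define s e where "s = a + b + c" and "e = a * b + b * c + c * a + 1"
    have e: "e > 0" using w by (simp add: e_def add_pos_pos)
    have "4 * e \<le> (w - s)\<^sup>2" using False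
      by (simp add: Q_eq_quadratic e_def s_def w_def a_def b_def c_def)
    \<comment> \<open>Each of \<open>a\<close>, \<open>b\<close>, \<open>c\<close> is at most
      \<open>w\<close>, so \<open>s - w\<close> is at most the sum of any two of them. Multiplying
      two such bounds that share the smaller of \<open>a\<close> and \<open>c\<close> keeps the
      square below \<open>4 * e\<close>.\<close>
    moreover have "(w - s)\<^sup>2 < 4 * e" if "w \<le> s"
    proof -
      have pr: "a * b > 0" "b * c > 0" "c * a > 0" using w by simp_all
      have "(w - s)\<^sup>2 = (s - w) * (s - w)" by (simp add: power2_eq_square algebra_simps)
      also have "\<dots> \<le> a * b + b * c + c * a + c * a"
      proof (cases "a \<le> c")
        case True
        have "(s - w) * (s - w) \<le> (a + b) * (a + c)"
          using that w by (intro mult_mono) (auto simp: s_def)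
        also have "\<dots> = a * b + b * c + c * a + a * a" by (simp add: algebra_simps)
        also have "a * a \<le> c * a" using True w by simp
        finally show ?thesis by simp
      next
        case False
        have "(s - w) * (s - w) \<le> (c + b) * (c + a)"
          using that w by (intro mult_mono) (auto simp: s_def)
        also have "\<dots> = a * b + b * c + c * a + c * c" by (simp add: algebra_simps)
        also have "c * c \<le> c * a" using False w by simp
        finally show ?thesis by simp
      qed
      also have "\<dots> < 4 * e" using pr by (simp add: e_def mult.commute[of c a] add_pos_pos)
      finally show ?thesis .
    qed
    ultimately have "s < w" by (meson linorder_not_less)
    have "2 * sqrt e = sqrt (4 * e)" by (simp add: real_sqrt_mult)
    also have "\<dots> \<le> w - s"
      using \<open>4 * e \<le> (w - s)\<^sup>2\<close> \<open>s < w\<close> by (intro real_le_lsqrt) auto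
    finally have "in_D ri rj rk rl"
      by (simp add: in_D_def s_def e_def w_def a_def b_def c_def)
    with False show ?thesis by (simp add: ext_solid_angle_def regular_solid_angle_bounds)
  qed
qed

end

section \<open>Curvature at vertices of extremal radius\<close>

lemma ext_solid_angle_commute:
  assumes "ri > 0" "rj > 0" "rk > 0" "rl > 0"
  shows "ext_solid_angle ri rj rk rl = ext_solid_angle ri rk rj rl"
    "ext_solid_angle ri rj rk rl = ext_solid_angle ri rj rl rk"
proof -
  have "coth_excess_cos w a b c = coth_excess_cos w b a c"
    "coth_excess_cos w a b c = coth_excess_cos w a c b" for w a b c
    by (fact coth_excess_cos_commute)+
  moreover have "in_D ri rj rk rl = in_D ri rk rj rl" "in_D ri rj rk rl = in_D ri rj rl rk"
    by (simp_all add: in_D_def add_ac mult_ac)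
  ultimately show "ext_solid_angle ri rj rk rl = ext_solid_angle ri rk rj rl"
    "ext_solid_angle ri rj rk rl = ext_solid_angle ri rj rl rk"
    using assms Q_commute[of ri rj rk rl]
    unfolding ext_solid_angle_def by (simp_all add: solid_angle_eq(1))
qed

text \<open>Resolves the description in \<open>angle_at\<close>: the other three vertices can be
  listed in six orders, and the two symmetries of \<open>f\<close> generate all of them.\<close>

lemma angle_at_eq:
  assumes sym: "\<And>a b c d. a > 0 \<Longrightarrow> b > 0 \<Longrightarrow> c > 0 \<Longrightarrow> d > 0 \<Longrightarrow> f a b c d = f a c b d"
     "\<And>a b c d. a > 0 \<Longrightarrow> b > 0 \<Longrightarrow> c > 0 \<Longrightarrow> d > 0 \<Longrightarrow> f a b c d = f a b d c"
    and r: "ball_packing r" and d: "distinct [i, j, k, l]"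
  shows "angle_at f r i {i, j, k, l} = f (r $ i) (r $ j) (r $ k) (r $ l)"
  unfolding angle_at_def
proof (rule the_equality)
  show "\<exists>j' k' l'. distinct [i, j', k', l'] \<and> {i, j, k, l} = {i, j', k', l'} \<and>
     f (r $ i) (r $ j) (r $ k) (r $ l) = f (r $ i) (r $ j') (r $ k') (r $ l')"
    using d by blast
  have p: "r $ m > 0" for m using r by (simp add: ball_packing_def)
  fix a assume "\<exists>j' k' l'. distinct [i, j', k', l'] \<and> {i, j, k, l} = {i, j', k', l'} \<and>
     a = f (r $ i) (r $ j') (r $ k') (r $ l')"
  then obtain j' k' l' where d': "distinct [i, j', k', l']" and eq: "{i, j, k, l} = {i, j', k', l'}"
    and a: "a = f (r $ i) (r $ j') (r $ k') (r $ l')" by blast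
  have "j' \<in> {j, k, l}" "k' \<in> {j, k, l}" "l' \<in> {j, k, l}" using eq d d' by auto
  then consider "j' = j" "k' = k" "l' = l" | "j' = j" "k' = l" "l' = k" | "j' = k" "k' = j" "l' = l"
    | "j' = k" "k' = l" "l' = j" | "j' = l" "k' = j" "l' = k" | "j' = l" "k' = k" "l' = j"
    using d' by auto
  then show "a = f (r $ i) (r $ j) (r $ k) (r $ l)"
    unfolding a by cases (metis sym p)+
qed

lemma tetrahedra_atE:
  assumes "\<sigma> \<in> tetrahedra_at T i"
  obtains j k l where "distinct [i, j, k, l]" "\<sigma> = {i, j, k, l}" "{i, j, k, l} \<in> T"
proof -
  from assms have s: "\<sigma> \<in> T" "card \<sigma> = 4" "i \<in> \<sigma>" by (auto simp: tetrahedra_at_def)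
  then have "card (\<sigma> - {i}) = 3" by simp
  then obtain j k l where "\<sigma> - {i} = {j, k, l}" "j \<noteq> k" "j \<noteq> l" "k \<noteq> l"
    by (auto simp: card_3_iff)
  with s that[of j k l] show ?thesis
      by (metis Diff_iff distinct_length_2_or_more distinct_singleton insertCI insert_Diff)
qed

lemma angle_at_ext_eq:
  assumes "ball_packing r" "distinct [i, j, k, l]"
  shows "angle_at ext_solid_angle r i {i, j, k, l} = ext_solid_angle (r $ i) (r $ j) (r $ k) (r $ l)"
  using assms by (intro angle_at_eq ext_solid_angle_commute)

text \<open>A globally largest radius is largest in each of the \<open>d\<close> tetrahedra at its
  vertex, so every summand is bounded by the regular angle.\<close>

lemma ext_curvature_at_max:
  assumes "tetra_regular T d" "ball_packing r" and max: "\<And>j. r $ j \<le> r $ i"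
  shows "4 * pi - d * regular_solid_angle (r $ i) \<le> ext_curvature T r i"
proof -
  have "angle_at ext_solid_angle r i \<sigma> \<le> regular_solid_angle (r $ i)" if "\<sigma> \<in> tetrahedra_at T i" for \<sigma>
    using that
  proof (rule tetrahedra_atE)
    fix j k l assume "distinct [i, j, k, l]" "\<sigma> = {i, j, k, l}"
    then show ?thesis using assms(2) max
      by (simp add: angle_at_ext_eq ball_packing_def ext_solid_angle_le_regular)
  qed
  from sum_bounded_above[of "tetrahedra_at T i", OF this]
  show ?thesis using assms(1) by (simp add: ext_curvature_def tetra_regular_def)
qed

lemma ext_curvature_at_min:
  assumes "tetra_regular T d" "ball_packing r" and min: "\<And>j. r $ i \<le> r $ j"
  shows "ext_curvature T r i \<le> 4 * pi - d * regular_solid_angle (r $ i)"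
proof -
  have "regular_solid_angle (r $ i) \<le> angle_at ext_solid_angle r i \<sigma>" if "\<sigma> \<in> tetrahedra_at T i" for \<sigma>
    using that
  proof (rule tetrahedra_atE)
    fix j k l assume "distinct [i, j, k, l]" "\<sigma> = {i, j, k, l}"
    then show ?thesis using assms(2) min
      by (simp add: angle_at_ext_eq ball_packing_def ext_solid_angle_ge_regular)
  qed
  from sum_bounded_below[of "tetrahedra_at T i", OF this]
  show ?thesis using assms(1) by (simp add: ext_curvature_def tetra_regular_def)
qed

lemma real_packing_ext_curvature:
  assumes "real_packing T r"
  shows "ext_curvature T r i = curvature T r i"
proof -
  have "angle_at ext_solid_angle r i \<sigma> = angle_at solid_angle r i \<sigma>" if "\<sigma> \<in> tetrahedra_at T i" for \<sigma>
  proof -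
    have "\<sigma> \<in> T" using that by (simp add: tetrahedra_at_def)
    then have "ext_solid_angle (r $ i) (r $ j) (r $ k) (r $ l) = solid_angle (r $ i) (r $ j) (r $ k) (r $ l)"
      if "distinct [i, j, k, l]" "\<sigma> = {i, j, k, l}" for j k l
      using that assms real_tetrahedron_iff_Q[of "r $ i" "r $ j" "r $ k" "r $ l"]
      by (auto simp: real_packing_def ball_packing_def ext_solid_angle_def)
    then show ?thesis unfolding angle_at_def by (metis (no_types, opaque_lifting))
  qed
  then show ?thesis by (simp add: ext_curvature_def curvature_def)
qed

text \<open>With all cotangents equal to \<open>c\<close>, \<open>Q\<close> is
  \<open>8 * c\<^sup>2 + 4\<close>.\<close>

lemma real_packing_vec:
  assumes "r > 0"
  shows "real_packing T (vec r)"
proof -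
  have "Q r r r r > 0"
    using assms by (simp add: Q_def power2_eq_square algebra_simps add_pos_nonneg)
  then show ?thesis
    using assms by (simp add: real_packing_def ball_packing_def real_tetrahedron_iff_Q)
qed

section \<open>The regular solid angle\<close>

lemma regular_excess_cos2_tanh_deriv:
  "((\<lambda>r::real. regular_excess_cos2 ((1 + (tanh r)\<^sup>2) / 2)) has_real_derivative
    6 * (1 + 3 * ((1 + (tanh r)\<^sup>2) / 2)) * (1 - (1 + (tanh r)\<^sup>2) / 2) /
      (4 * (1 + (1 + (tanh r)\<^sup>2) / 2) ^ 4) * (tanh r * (1 - (tanh r)\<^sup>2))) (at r)"
proof (rule DERIV_chain2[OF regular_excess_cos2_deriv])
  show "((\<lambda>r. (1 + (tanh r)\<^sup>2) / 2) has_real_derivative (tanh r * (1 - (tanh r)\<^sup>2))) (at r)"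
    by (auto intro!: derivative_eq_intros)
qed simp

lemma regular_excess_cos2_tanh_continuous:
  "continuous_on S (\<lambda>r::real. regular_excess_cos2 ((1 + (tanh r)\<^sup>2) / 2))"
  using regular_excess_cos2_tanh_deriv DERIV_isCont by (intro continuous_at_imp_continuous_on) blast

text \<open>The derivative is continuous and positive on the compact interval, so its minimum there
  serves as \<open>c\<close>. The interval must avoid 0, where the derivative vanishes.\<close>

lemma regular_excess_cos2_tanh_gap:
  fixes m R :: real
  assumes "0 < m"
  obtains c where "c > 0" "\<And>r s. m \<le> r \<Longrightarrow> r \<le> s \<Longrightarrow> s \<le> R \<Longrightarrow>
    c * (s - r) \<le> regular_excess_cos2 ((1 + (tanh s)\<^sup>2) / 2) - regular_excess_cos2 ((1 + (tanh r)\<^sup>2) / 2)"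
proof -
  define D where "D = (\<lambda>r::real. 6 * (1 + 3 * ((1 + (tanh r)\<^sup>2) / 2)) * (1 - (1 + (tanh r)\<^sup>2) / 2) /
     (4 * (1 + (1 + (tanh r)\<^sup>2) / 2) ^ 4) * (tanh r * (1 - (tanh r)\<^sup>2)))"
  have pos: "1 + (1 + (tanh r)\<^sup>2) / 2 > 0" for r :: real
    by (intro add_pos_nonneg) auto
  have "D r > 0" if "r > 0" for r
    using that tanh_square_bounds[of r] pos[of r] unfolding D_def
    by (intro mult_pos_pos divide_pos_pos zero_less_power) (auto intro: add_pos_nonneg)
  moreover have "continuous_on {m..R} D"
    unfolding D_def using pos by (intro continuous_intros) (auto simp: less_imp_neq[symmetric])
  ultimately obtain c where c: "c > 0" "\<And>r. r \<in> {m..R} \<Longrightarrow> c \<le> D r"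
  proof (cases "m \<le> R")
    case True
    assume "\<And>r. r > 0 \<Longrightarrow> D r > 0" and "continuous_on {m..R} D"
    with True obtain x where "x \<in> {m..R}" "\<forall>y\<in>{m..R}. D x \<le> D y"
      using continuous_attains_inf[of "{m..R}" D] by auto
    then show ?thesis using that[of "D x"] \<open>\<And>r. r > 0 \<Longrightarrow> D r > 0\<close> assms by auto
  next
    case False
    then show ?thesis using that[of 1] by auto
  qed
  show ?thesis
  proof (rule that[OF c(1)])
    fix r s assume rs: "m \<le> r" "r \<le> s" "s \<le> R"
    let ?f = "\<lambda>r::real. regular_excess_cos2 ((1 + (tanh r)\<^sup>2) / 2) - c * r"
    have "?f r \<le> ?f s"
    proof (rule DERIV_nonneg_imp_nondecreasing[OF \<open>r \<le> s\<close>])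
      fix x assume x: "r \<le> x" "x \<le> s"
      have "((\<lambda>r. regular_excess_cos2 ((1 + (tanh r)\<^sup>2) / 2)) has_real_derivative D x) (at x)"
        unfolding D_def by (rule regular_excess_cos2_tanh_deriv)
      then have "(?f has_real_derivative D x - c) (at x)"
        by (auto intro!: derivative_eq_intros)
      moreover have "D x - c \<ge> 0" using c(2)[of x] x rs by auto
      ultimately show "\<exists>y. (?f has_real_derivative y) (at x) \<and> 0 \<le> y" by blast
    qed
    then show "c * (s - r) \<le>
          regular_excess_cos2 ((1 + (tanh s)\<^sup>2) / 2) - regular_excess_cos2 ((1 + (tanh r)\<^sup>2) / 2)"
      by (simp add: algebra_simps)
  qed
qed

text \<open>\<open>x + cos x\<close> is nondecreasing, so the difference of the roots is at most
  that of the angles, and \<open>b - a\<close> is at most twice the former. This avoids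
  differentiating \<open>arccos\<close> and \<open>sqrt\<close> at the ends of their
  domains.\<close>

lemma arccos_sqrt_gap:
  assumes "0 \<le> a" "a \<le> b" "b \<le> 1"
  shows "b - a \<le> 2 * arccos (sqrt a) - 2 * arccos (sqrt b)"
proof -
  have ab: "0 \<le> sqrt a" "sqrt a \<le> sqrt b" "sqrt b \<le> 1" "-1 \<le> sqrt a" "-1 \<le> sqrt b"
    using assms by (auto intro: order_trans[of _ 0])
  have le: "arccos (sqrt b) \<le> arccos (sqrt a)" using ab by (intro arccos_le_arccos) auto
  have "\<exists>D. ((\<lambda>x. x + cos x) has_real_derivative D) (at x) \<and> 0 \<le> D" for x
    by (intro exI[of _ "1 - sin x"]) (auto intro!: derivative_eq_intros)
  then have "arccos (sqrt b) + cos (arccos (sqrt b)) \<le> arccos (sqrt a) + cos (arccos (sqrt a))"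
    by (rule DERIV_nonneg_imp_nondecreasing[OF le])
  moreover have "cos (arccos (sqrt a)) = sqrt a" "cos (arccos (sqrt b)) = sqrt b"
    using ab by (auto intro!: cos_arccos)
  ultimately have "sqrt b - sqrt a \<le> arccos (sqrt a) - arccos (sqrt b)" by linarith
  then have "2 * (sqrt b - sqrt a) \<le> 2 * arccos (sqrt a) - 2 * arccos (sqrt b)" by simp
  moreover have "b - a = (sqrt b + sqrt a) * (sqrt b - sqrt a)"
    using assms by (simp add: algebra_simps)
  moreover have "\<dots> \<le> 2 * (sqrt b - sqrt a)"
    by (intro mult_right_mono) (use ab in linarith)+
  ultimately show ?thesis by linarith
qed

text \<open>This linear rate of decrease yields strict monotonicity and, later, the exponential
  rates of the barriers.\<close>

lemma regular_solid_angle_gap: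
  fixes m R :: real
  assumes "0 < m"
  obtains c where "c > 0" "\<And>r s. m \<le> r \<Longrightarrow> r \<le> s \<Longrightarrow> s \<le> R \<Longrightarrow>
    c * (s - r) \<le> regular_solid_angle r - regular_solid_angle s"
proof -
  obtain c where c: "c > 0" "\<And>r s. m \<le> r \<Longrightarrow> r \<le> s \<Longrightarrow> s \<le> R \<Longrightarrow>
    c * (s - r) \<le> regular_excess_cos2 ((1 + (tanh s)\<^sup>2) / 2) - regular_excess_cos2 ((1 + (tanh r)\<^sup>2) / 2)"
    using regular_excess_cos2_tanh_gap[OF assms] by metis
  show ?thesis
  proof (rule that[OF c(1)])
    fix r s assume rs: "m \<le> r" "r \<le> s" "s \<le> R"
    have bd: "0 \<le> regular_excess_cos2 ((1 + (tanh q)\<^sup>2) / 2)" "regular_excess_cos2 ((1 + (tanh q)\<^sup>2) / 2) \<le> 1"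
      for q :: real using tanh_square_bounds[of q] by (intro regular_excess_cos2_bounds; simp)+
    have g: "c * (s - r) \<le>
          regular_excess_cos2 ((1 + (tanh s)\<^sup>2) / 2) - regular_excess_cos2 ((1 + (tanh r)\<^sup>2) / 2)"
      using rs by (rule c(2))
    moreover have "0 \<le> c * (s - r)" using c(1) rs by simp
    ultimately show "c * (s - r) \<le> regular_solid_angle r - regular_solid_angle s"
      using arccos_sqrt_gap[OF bd(1)[of r] _ bd(2)[of s]] unfolding regular_solid_angle_def by linarith
  qed
qed

lemma regular_solid_angle_strict_antimono:
  assumes "0 < r" "r < s"
  shows "regular_solid_angle s < regular_solid_angle r"
proof -
  obtain c where "c > 0" "c * (s - r) \<le> regular_solid_angle r - regular_solid_angle s"
    using regular_solid_angle_gap[OF assms(1), of s] assms by (metis order_refl less_imp_le)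
  moreover from this have "c * (s - r) > 0" using assms by simp
  ultimately show ?thesis by linarith
qed

text \<open>\<open>25/27\<close> is the squared cosine of half the solid angle of the regular Euclidean tetrahedron,
  the limit \<open>r \<rightarrow> 0\<close>.\<close>

lemma regular_solid_angle_le_euclidean: "regular_solid_angle r \<le> 2 * arccos (sqrt (25 / 27))"
proof -
  have "regular_excess_cos2 (1 / 2) \<le> regular_excess_cos2 ((1 + (tanh r)\<^sup>2) / 2)"
    using tanh_square_bounds[of r] by (intro regular_excess_cos2_mono) auto
  moreover have "regular_excess_cos2 (1 / 2) = 25 / 27"
    by (simp add: regular_excess_cos2_def power2_eq_square power3_eq_cube)
  moreover have "regular_excess_cos2 ((1 + (tanh r)\<^sup>2) / 2) \<le> 1"
    using tanh_square_bounds[of r] by (intro regular_excess_cos2_bounds) auto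
  ultimately show ?thesis
    unfolding regular_solid_angle_def
        by (intro mult_left_mono arccos_le_arccos) (auto intro: order_trans[of _ 0])
qed

section \<open>The threshold between degrees 22 and 23\<close>

text \<open>\<open>pi / 11\<close> is half of \<open>4 * pi / 22\<close>, the share of each of 22
  tetrahedra. The cubic error bound for the sine at \<open>pi / 22\<close> gives a cosine of at most
  0.96.\<close>

lemma cos_pi_11: "cos (pi / 11) < sqrt (25 / 27)"
proof -
  define y where "y = pi / 22"
  have y: "0.1427 \<le> y" "y \<le> 0.1429" using pi_approx by (simp_all add: y_def)
  have "\<bar>sin y - y\<bar> \<le> \<bar>y\<bar> ^ 3 / 6"
    using Maclaurin_sin_bound[of y 3] by (simp add: sin_coeff_def numeral_eq_Suc fact_numeral)
  moreover have "\<bar>y\<bar> ^ 3 / 6 \<le> 0.1429 ^ 3 / 6"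
    using y by (intro divide_right_mono power_mono) auto
  moreover have "(0.1429 ^ 3 / 6 :: real) \<le> 0.0005" by (simp add: power3_eq_cube)
  ultimately have "sin y \<ge> 0.1422" using y by linarith
  then have "0.1422\<^sup>2 \<le> (sin y)\<^sup>2" by (intro power_mono) auto
  moreover have "cos (pi / 11) = 1 - 2 * (sin y)\<^sup>2"
    using cos_double_sin[of y] by (simp add: y_def)
  ultimately have "cos (pi / 11) \<le> 0.96" by (simp add: power2_eq_square)
  moreover have "(0.96 :: real) < sqrt (25 / 27)" by (rule real_less_rsqrt) (simp add: power2_eq_square)
  ultimately show ?thesis by linarith
qed

text \<open>\<open>2 * pi / 23\<close> is half of \<open>4 * pi / 23\<close>. Here the estimate
  \<open>sin y \<le> y\<close> suffices, but only narrowly: the square of 0.9626 barely exceeds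
  25/27.\<close>

lemma cos_2pi_23: "sqrt (25 / 27) < cos (2 * pi / 23)"
proof -
  define y where "y = pi / 23"
  have y: "0 \<le> y" "y \<le> 0.1367" using pi_approx by (simp_all add: y_def)
  then have "0 \<le> sin y" "sin y \<le> 0.1367"
    using sin_x_le_x[of y] pi_approx by (auto intro!: sin_ge_zero)
  then have "(sin y)\<^sup>2 \<le> 0.1367\<^sup>2" by (intro power_mono) auto
  moreover have "cos (2 * pi / 23) = 1 - 2 * (sin y)\<^sup>2"
    using cos_double_sin[of y] by (simp add: y_def)
  ultimately have "cos (2 * pi / 23) \<ge> 0.9626" by (simp add: power2_eq_square)
  moreover have "sqrt (25 / 27) < (0.9626 :: real)" by (rule real_less_lsqrt) (simp_all add: power2_eq_square)
  ultimately show ?thesis by linarith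
qed

text \<open>The surplus \<open>e\<close> is independent of \<open>r\<close>, which gives a uniform
  decay rate in \<open>flow_tendsto_zero\<close>.\<close>

lemma regular_angle_sum_lt:
  fixes d :: nat
  assumes "d \<le> 22"
  shows "\<exists>e>0. \<forall>r. d * regular_solid_angle r \<le> 4 * pi - e"
proof -
  have "arccos (sqrt (25 / 27)) < arccos (cos (pi / 11))"
    using cos_pi_11 by (intro arccos_less_arccos) auto
  also have "\<dots> = pi / 11" by (intro arccos_cos) auto
  finally have "4 * pi - 44 * arccos (sqrt (25 / 27)) > 0" by simp
  moreover have "d * regular_solid_angle r \<le> 44 * arccos (sqrt (25 / 27))" for r
  proof -
    have "d * regular_solid_angle r \<le> 22 * (2 * arccos (sqrt (25 / 27)))"
      using assms regular_solid_angle_bounds(1)[of r] regular_solid_angle_le_euclidean[of r]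
      by (intro mult_mono) auto
    then show ?thesis by simp
  qed
  ultimately show ?thesis by (intro exI[of _ "4 * pi - 44 * arccos (sqrt (25 / 27))"]) auto
qed

text \<open>Intermediate value theorem for the squared cosine of half the regular angle, which runs
  from 25/27 at 0 to the limit 1 at infinity. \<open>cos_2pi_23\<close> puts the target above
  25/27.\<close>

lemma regular_angle_sum_eq:
  fixes d :: nat
  assumes "d \<ge> 23"
  obtains r where "r > 0" "d * regular_solid_angle r = 4 * pi"
proof -
  define y where "y = (cos (2 * pi / d))\<^sup>2"
  have "real d \<ge> 23" using assms by simp
  then have d: "2 * pi / d \<le> 2 * pi / 23" "0 < 2 * pi / d"
    by (rule divide_left_mono) (use \<open>real d \<ge> 23\<close> in simp_all)
  have half: "2 * pi / d < pi / 2" using d pi_gt_zero by linarith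
  have cos: "cos (2 * pi / 23) \<le> cos (2 * pi / d)"
    using d pi_gt_zero by (intro cos_monotone_0_pi_le) auto
  have c1: "cos (2 * pi / d) < 1"
    using d half cos_monotone_0_pi[of 0 "2 * pi / d"] by simp
  have c0: "cos (2 * pi / d) > 0" using d half by (intro cos_gt_zero) auto
  have "sqrt (25 / 27) < cos (2 * pi / d)" using cos_2pi_23 cos by linarith
  then have "(sqrt (25 / 27))\<^sup>2 < y" unfolding y_def by (intro power_strict_mono) auto
  then have y0: "25 / 27 < y" by simp
  have y1: "y < 1" unfolding y_def using c0 c1 by (simp add: power_less_one_iff)
  let ?f = "\<lambda>r::real. regular_excess_cos2 ((1 + (tanh r)\<^sup>2) / 2)"
  have f0: "?f 0 = 25 / 27"
    by (simp add: regular_excess_cos2_def power2_eq_square power3_eq_cube)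
  have "isCont regular_excess_cos2 1"
    using regular_excess_cos2_deriv[of 1] DERIV_isCont by auto
  moreover have "((\<lambda>r::real. (1 + (tanh r)\<^sup>2) / 2) \<longlongrightarrow> (1 + 1\<^sup>2) / 2) at_top"
    by (intro tendsto_intros tanh_real_at_top) auto
  ultimately have "(?f \<longlongrightarrow> regular_excess_cos2 1) at_top"
    using isCont_tendsto_compose[of 1 regular_excess_cos2] by simp
  then have "(?f \<longlongrightarrow> 1) at_top" by (simp add: regular_excess_cos2_def)
  from order_tendstoD(1)[OF this y1] have "eventually (\<lambda>r. y < ?f r \<and> 0 \<le> r) at_top"
    by (intro eventually_conj eventually_ge_at_top)
  then obtain R where R: "y < ?f R" "0 \<le> R"
      by (metis (no_types, lifting) eventually_happens trivial_limit_at_top_linorder)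
  have "continuous_on {0..R} ?f"
    by (rule continuous_on_subset[OF regular_excess_cos2_tanh_continuous]) auto
  with IVT'[of ?f 0 y R] R y0 f0 obtain r where r: "0 \<le> r" "?f r = y" by auto
  with f0 y0 have "r > 0" by (cases "r = 0") auto
  moreover have "d * regular_solid_angle r = 4 * pi"
  proof -
    have "sqrt y = cos (2 * pi / d)" using c0 by (simp add: y_def)
    then have "regular_solid_angle r = 2 * (2 * pi / d)"
      using r(2) d half by (simp add: regular_solid_angle_def arccos_cos)
    then show ?thesis using assms by simp
  qed
  ultimately show ?thesis using that by blast
qed

section \<open>Barriers for the flow\<close>

text \<open>With a smaller slope at the touching time, \<open>f\<close> would lie above
  \<open>b\<close> just before it.\<close>

lemma has_real_derivative_ge_of_below:
  fixes f b :: "real \<Rightarrow> real"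
  assumes f: "(f has_real_derivative f') (at t within {0..})"
    and b: "(b has_real_derivative b') (at t within {0..})"
    and "0 < t" and below: "\<And>s. 0 \<le> s \<Longrightarrow> s < t \<Longrightarrow> f s \<le> b s" and "f t = b t"
  shows "b' \<le> f'"
proof (rule ccontr)
  assume "\<not> b' \<le> f'"
  then have "f' - b' < 0" by simp
  moreover have "at t within {0..} = at t"
    using \<open>0 < t\<close> by (intro at_within_open_subset[of _ "{0<..}"]) auto
  ultimately obtain e where e: "e > 0" "\<And>h. 0 < h \<Longrightarrow> h < e \<Longrightarrow> f t - b t < f (t - h) - b (t - h)"
    using DERIV_neg_dec_left[of "\<lambda>x. f x - b x" "f' - b'" t] f b
    by (auto intro: DERIV_diff)
  define h where "h = min (e / 2) (t / 2)"
  have "0 < h" "h < e" "h < t" using e(1) \<open>0 < t\<close> by (auto simp: h_def)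
  with e(2)[of h] below[of "t - h"] \<open>f t = b t\<close> show False by simp
qed

text \<open>At the first time some member reaches \<open>b\<close>, no member exceeds
  \<open>b\<close>, so the touching one is largest and \<open>touch\<close> applies; this
  contradicts \<open>has_real_derivative_ge_of_below\<close>.\<close>

lemma finite_family_barrier:
  fixes f f' :: "'i::finite \<Rightarrow> real \<Rightarrow> real" and b b' :: "real \<Rightarrow> real"
  assumes f: "\<And>i t. 0 \<le> t \<Longrightarrow> (f i has_real_derivative f' i t) (at t within {0..})"
    and b: "\<And>t. 0 \<le> t \<Longrightarrow> (b has_real_derivative b' t) (at t within {0..})"
    and init: "\<And>i. f i 0 < b 0"
    and touch: "\<And>i t. 0 < t \<Longrightarrow> f i t = b t \<Longrightarrow> (\<And>j. f j t \<le> f i t) \<Longrightarrow> f' i t < b' t"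
    and "0 \<le> t"
  shows "f i t < b t"
proof (rule ccontr)
  assume neg: "\<not> f i t < b t"
  define g where "g = (\<lambda>j s. b s - f j s)"
  have "\<And>j s. 0 \<le> s \<Longrightarrow> continuous (at s within {0..}) (g j)"
    unfolding g_def using f b by (intro continuous_diff) (blast intro: DERIV_continuous)+
  then have cont: "continuous_on {0..} (g j)" for j
    by (simp add: continuous_on_eq_continuous_within)
  \<comment> \<open>The times up to \<open>t\<close> at which some member has reached
    \<open>b\<close>; the set is compact, so it has a first element.\<close>
  define S where "S = (\<Union>j. {0..t} \<inter> g j -` {..0})"
  have "closed ({0..t} \<inter> g j -` {..0})" for j
    by (intro continuous_closed_preimage continuous_on_subset[OF cont]) auto
  then have "closed S" unfolding S_def by (intro closed_UN) auto
  moreover have "bounded S"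
    by (rule bounded_subset[OF bounded_closed_interval[of 0 t]]) (auto simp: S_def)
  ultimately have "compact S" by (simp add: compact_eq_bounded_closed)
  moreover have "t \<in> S"
    unfolding S_def using neg \<open>0 \<le> t\<close> by (intro UN_I[of i]) (auto simp: g_def)
  then have "S \<noteq> {}" by blast
  ultimately obtain s where s: "s \<in> S" "\<And>s'. s' \<in> S \<Longrightarrow> s \<le> s'"
    using compact_attains_inf by metis
  then obtain j where j: "0 \<le> s" "s \<le> t" "g j s \<le> 0" by (auto simp: S_def)
  have below: "f k s' < b s'" if "0 \<le> s'" "s' < s" for k s'
  proof (rule ccontr)
    assume "\<not> f k s' < b s'"
    then have "s' \<in> S" using that j by (auto simp: S_def g_def not_less)
    with s(2) that show False by force
  qed
  have "s \<noteq> 0" using j(3) init[of j] by (auto simp: g_def)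
  with j have "0 < s" by simp
  \<comment> \<open>At \<open>s\<close> itself the bound is the limit of the strict bounds from the
    left.\<close>
  have le: "f k s \<le> b s" for k
  proof -
    have "(g k \<longlongrightarrow> g k s) (at s within {0..s})"
      using cont[of k] \<open>0 < s\<close> continuous_on_subset[of "{0..}" "g k" "{0..s}"]
      by (auto simp: continuous_on_def)
    moreover have "eventually (\<lambda>x. 0 \<le> g k x) (at s within {0..s})"
      using below[of _ k] by (auto simp: eventually_at_filter g_def intro!: always_eventually less_imp_le)
    moreover have "at s within {0..s} \<noteq> bot"
      using \<open>0 < s\<close> by (simp add: trivial_limit_within islimpt_Icc)
    ultimately have "0 \<le> g k s" by (intro tendsto_lowerbound)
    then show ?thesis by (simp add: g_def)
  qed
  have eq: "f j s = b s" using le[of j] j by (simp add: g_def)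
  with touch[OF \<open>0 < s\<close>] le have "f' j s < b' s" by metis
  moreover have "b' s \<le> f' j s"
    using has_real_derivative_ge_of_below[OF f b \<open>0 < s\<close> _ eq] j below less_imp_le by metis
  ultimately show False by simp
qed

section \<open>Scalar barriers for the radii\<close>

lemma ext_yamabe_flow_component:
  assumes "ext_yamabe_flow T r0 r" "0 \<le> t"
  shows "((\<lambda>t. r t $ i) has_real_derivative - ext_curvature T (r t) i * sinh (r t $ i)) (at t within {0..})"
proof -
  have "(r has_vector_derivative (\<chi> i. - ext_curvature T (r t) i * sinh (r t $ i))) (at t within {0..})"
    using assms by (simp add: ext_yamabe_flow_def)
  from bounded_linear.has_vector_derivative[OF bounded_linear_vec_nth this, of i]
  show ?thesis by (simp add: has_real_derivative_iff_has_vector_derivative)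
qed

context
  fixes T :: "'n::finite set set" and d :: nat and r0 :: "real^'n" and r :: "real \<Rightarrow> real^'n"
  assumes regular: "tetra_regular T d" and flow: "ext_yamabe_flow T r0 r"
begin

lemma flow_pos: "0 \<le> t \<Longrightarrow> r t $ i > 0"
  using flow by (simp add: ext_yamabe_flow_def ball_packing_def)

lemma flow_packing: "0 \<le> t \<Longrightarrow> ball_packing (r t)"
  using flow by (simp add: ext_yamabe_flow_def)

text \<open>\<open>slope\<close> says that \<open>b\<close> is a strict supersolution of the scalar
  equation. A largest radius touching \<open>b\<close> is controlled by
  \<open>ext_curvature_at_max\<close>.\<close>

lemma flow_upper_barrier:
  assumes b: "\<And>t. 0 \<le> t \<Longrightarrow> (b has_real_derivative b' t) (at t within {0..})"
    and init: "\<And>i. r 0 $ i < b 0"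
    and slope: "\<And>t. 0 < t \<Longrightarrow> 0 < b t \<Longrightarrow> (d * regular_solid_angle (b t) - 4 * pi) * sinh (b t) < b' t"
    and "0 \<le> t"
  shows "r t $ i < b t"
proof (rule finite_family_barrier[OF ext_yamabe_flow_component[OF flow] b init _ \<open>0 \<le> t\<close>])
  fix i t assume t: "(0::real) < t" "r t $ i = b t" "\<And>j. r t $ j \<le> r t $ i"
  have pos: "0 < b t" using flow_pos[of t i] t by simp
  have "4 * pi - d * regular_solid_angle (r t $ i) \<le> ext_curvature T (r t) i"
    using t by (intro ext_curvature_at_max[OF regular flow_packing]) auto
  then have "- ext_curvature T (r t) i \<le> d * regular_solid_angle (b t) - 4 * pi"
    unfolding t(2) by linarith
  from mult_right_mono[OF this, of "sinh (b t)"]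
  have "- ext_curvature T (r t) i * sinh (r t $ i) \<le> (d * regular_solid_angle (b t) - 4 * pi) * sinh (b t)"
    using pos t(2) by simp
  then show "- ext_curvature T (r t) i * sinh (r t $ i) < b' t"
    using slope[OF t(1) pos] by linarith
qed

text \<open>The family barrier is applied to the negated radii, so the touching radius is a smallest
  one.\<close>

lemma flow_lower_barrier:
  assumes b: "\<And>t. 0 \<le> t \<Longrightarrow> (b has_real_derivative b' t) (at t within {0..})"
    and init: "\<And>i. b 0 < r 0 $ i"
    and slope: "\<And>t. 0 < t \<Longrightarrow> 0 < b t \<Longrightarrow> b' t < (d * regular_solid_angle (b t) - 4 * pi) * sinh (b t)"
    and "0 \<le> t"
  shows "b t < r t $ i"
proof -
  have "- (r t $ i) < - b t"
  proof (rule finite_family_barrier[of "\<lambda>i t. - (r t $ i)"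
      "\<lambda>i t. - (- ext_curvature T (r t) i * sinh (r t $ i))"
        "\<lambda>t. - b t" "\<lambda>t. - b' t"])
    fix i t assume t: "(0::real) < t" "- (r t $ i) = - b t" "\<And>j. - (r t $ j) \<le> - (r t $ i)"
    have pos: "0 < b t" using flow_pos[of t i] t by simp
    have "ext_curvature T (r t) i \<le> 4 * pi - d * regular_solid_angle (r t $ i)"
      using t by (intro ext_curvature_at_min[OF regular flow_packing]) auto
    then have "d * regular_solid_angle (b t) - 4 * pi \<le> - ext_curvature T (r t) i"
      using t(2) by simp
    from mult_right_mono[OF this, of "sinh (b t)"]
    have "(d * regular_solid_angle (b t) - 4 * pi) * sinh (b t) \<le> - ext_curvature T (r t) i * sinh (r t $ i)"
      using pos t(2) by simp
    then show "- (- ext_curvature T (r t) i * sinh (r t $ i)) < - b' t"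
      using slope[OF t(1) pos] by linarith
  next
    fix i and t :: real assume "0 \<le> t"
    from ext_yamabe_flow_component[OF flow this, of i]
    show "((\<lambda>t. - (r t $ i)) has_real_derivative
      - (- ext_curvature T (r t) i * sinh (r t $ i))) (at t within {0..})"
      by (rule DERIV_minus)
    from b[OF \<open>0 \<le> t\<close>]
    show "((\<lambda>t. - b t) has_real_derivative - b' t) (at t within {0..})"
      by (rule DERIV_minus)
  next
    show "- (r 0 $ i) < - b 0" for i using init by simp
  qed fact
  then show ?thesis by simp
qed

text \<open>If \<open>d * regular_solid_angle\<close> crosses \<open>4 * pi\<close> at \<open>rs\<close>, its slope there
  gives barriers that approach \<open>rs\<close> exponentially.\<close>

lemma flow_exponential_upper:
  assumes rs: "0 < rs" "d * regular_solid_angle rs = 4 * pi" and "0 < d"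
  shows "\<exists>C c. 0 < C \<and> 0 < c \<and> (\<forall>t\<ge>0. \<forall>i. r t $ i < rs + C * exp (- c * t))"
proof -
  define C where "C = 1 + (\<Sum>i\<in>UNIV. r 0 $ i)"
  have le: "r 0 $ i \<le> (\<Sum>i\<in>UNIV. r 0 $ i)" for i
    using flow_pos[of 0] by (intro member_le_sum) (auto intro: less_imp_le)
  have "0 \<le> (\<Sum>i\<in>UNIV. r 0 $ i)" using flow_pos[of 0] by (intro sum_nonneg) (auto intro: less_imp_le)
  then have C: "0 < C" "r 0 $ i < rs + C" for i using le[of i] rs by (auto simp: C_def)
  obtain k where k: "k > 0" "\<And>x y. rs \<le> x \<Longrightarrow> x \<le> y \<Longrightarrow> y \<le> rs + C \<Longrightarrow>
      k * (y - x) \<le> regular_solid_angle x - regular_solid_angle y"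
    using regular_solid_angle_gap[OF rs(1), of "rs + C"] by metis
  \<comment> \<open>Half of the available linear rate; the halving supplies the strict inequality
    that the barrier needs.\<close>
  define c where "c = d * k * sinh rs / 2"
  have c: "c > 0" using k \<open>0 < d\<close> rs by (simp add: c_def)
  have "r t $ i < rs + C * exp (- c * t)" if "0 \<le> t" for t i
  proof (rule flow_upper_barrier[where b' = "\<lambda>t. - c * (C * exp (- c * t))", OF _ _ _ that])
    fix t :: real assume "0 < t"
    define h where "h = C * exp (- c * t)"
    have h: "0 < h" "h \<le> C" using C c \<open>0 < t\<close> by (auto simp: h_def)
    have "d * (k * h) \<le> d * (regular_solid_angle rs - regular_solid_angle (rs + h))"
      using k(2)[of rs "rs + h"] h by (intro mult_left_mono) auto
    then have "d * (k * h) \<le> 4 * pi - d * regular_solid_angle (rs + h)"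
      using rs(2) by (simp add: right_diff_distrib)
    moreover have "sinh rs \<le> sinh (rs + h)" using h by simp
    ultimately have "d * (k * h) * sinh rs \<le> (4 * pi - d * regular_solid_angle (rs + h)) * sinh (rs + h)"
      using k h rs by (intro mult_mono') auto
    moreover have "d * (k * h) * sinh rs = 2 * c * h" by (simp add: c_def)
    moreover have "c * h < 2 * c * h" using c h by simp
    ultimately have "(d * regular_solid_angle (rs + h) - 4 * pi) * sinh (rs + h) < - c * h"
      by (simp add: left_diff_distrib)
    then show "(d * regular_solid_angle (rs + C * exp (- c * t)) - 4 * pi) * sinh (rs + C * exp (- c * t))
       < - c * (C * exp (- c * t))" by (simp add: h_def)
  qed (use C in \<open>auto intro!: derivative_eq_intros\<close>)
  with C c show ?thesis by blast
qed

lemma flow_exponential_lower: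
  assumes rs: "0 < rs" "d * regular_solid_angle rs = 4 * pi" and "0 < d"
  shows "\<exists>C c. 0 < C \<and> 0 < c \<and> (\<forall>t\<ge>0. \<forall>i. rs - C * exp (- c * t) < r t $ i)"
proof -
  define M where "M = Min (insert rs (range (\<lambda>i. r 0 $ i)))"
  \<comment> \<open>\<open>m\<close> lies below \<open>rs\<close> and below all initial radii. The
    barrier starts at \<open>m\<close> and rises towards \<open>rs\<close>, so it stays where the
    rate \<open>k\<close> is valid.\<close>
  define m where "m = M / 2"
  have M: "0 < M" unfolding M_def using rs flow_pos[of 0] by auto
  have le: "M \<le> rs" "M \<le> r 0 $ i" for i unfolding M_def by (intro Min_le; simp)+
  have m: "0 < m" "m < rs" "m < r 0 $ i" for i
    using M le(1) le(2)[of i] by (simp_all add: m_def)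
  define C where "C = rs - m"
  have C: "0 < C" using m by (simp add: C_def)
  obtain k where k: "k > 0" "\<And>x y. m \<le> x \<Longrightarrow> x \<le> y \<Longrightarrow> y \<le> rs \<Longrightarrow>
      k * (y - x) \<le> regular_solid_angle x - regular_solid_angle y"
    using regular_solid_angle_gap[OF m(1), of rs] by metis
  define c where "c = d * k * sinh m / 2"
  have c: "c > 0" using k \<open>0 < d\<close> m by (simp add: c_def)
  have "rs - C * exp (- c * t) < r t $ i" if "0 \<le> t" for t i
  proof (rule flow_lower_barrier[where b' = "\<lambda>t. c * (C * exp (- c * t))", OF _ _ _ that])
    fix t :: real assume "0 < t"
    define h where "h = C * exp (- c * t)"
    have h: "0 < h" "h \<le> C" using C c \<open>0 < t\<close> by (auto simp: h_def)
    have mh: "m \<le> rs - h" using h by (simp add: C_def)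
    have "d * (k * h) \<le> d * (regular_solid_angle (rs - h) - regular_solid_angle rs)"
      using k(2)[of "rs - h" rs] h mh by (intro mult_left_mono) auto
    then have "d * (k * h) \<le> d * regular_solid_angle (rs - h) - 4 * pi"
      using rs(2) by (simp add: right_diff_distrib)
    moreover have "sinh m \<le> sinh (rs - h)" using mh by simp
    ultimately have "d * (k * h) * sinh m \<le> (d * regular_solid_angle (rs - h) - 4 * pi) * sinh (rs - h)"
      using k h m by (intro mult_mono') auto
    moreover have "d * (k * h) * sinh m = 2 * c * h" by (simp add: c_def)
    moreover have "c * h < 2 * c * h" using c h by simp
    ultimately have "c * h < (d * regular_solid_angle (rs - h) - 4 * pi) * sinh (rs - h)"
      by linarith
    then show "c * (C * exp (- c * t)) <
       (d * regular_solid_angle (rs - C * exp (- c * t)) - 4 * pi) * sinh (rs - C * exp (- c * t))"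
      by (simp add: h_def)
  qed (use m in \<open>auto intro!: derivative_eq_intros simp: C_def\<close>)
  with C c show ?thesis by blast
qed

text \<open>The two barriers are combined with the smaller rate; the factor \<open>CARD('n)\<close>
  comes from bounding the norm by the sum of the components.\<close>

lemma flow_converges_exponentially:
  assumes rs: "0 < rs" "d * regular_solid_angle rs = 4 * pi" and "0 < d"
  shows "converges_exponentially r (vec rs)"
proof -
  obtain C1 c1 where 1: "0 < C1" "0 < c1" "\<And>t i. 0 \<le> t \<Longrightarrow> r t $ i < rs + C1 * exp (- c1 * t)"
    using flow_exponential_upper[OF assms] by blast
  obtain C2 c2 where 2: "0 < C2" "0 < c2" "\<And>t i. 0 \<le> t \<Longrightarrow> rs - C2 * exp (- c2 * t) < r t $ i"
    using flow_exponential_lower[OF assms] by blast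
  define c where "c = min c1 c2"
  define C where "C = C1 + C2"
  have "norm (r t - vec rs) \<le> CARD('n) * C * exp (- c * t)" if "0 \<le> t" for t
  proof -
    have "C1 * exp (- c1 * t) \<le> C * exp (- c * t)" "C2 * exp (- c2 * t) \<le> C * exp (- c * t)"
      using 1 2 that by (auto intro!: mult_mono mult_right_mono simp: C_def c_def)
    then have comp: "\<bar>(r t - vec rs) $ i\<bar> \<le> C * exp (- c * t)" for i
      using 1(3)[OF that, of i] 2(3)[OF that, of i] by (auto simp: abs_le_iff)
    have "norm (r t - vec rs) \<le> (\<Sum>i\<in>UNIV. \<bar>(r t - vec rs) $ i\<bar>)" by (rule norm_le_l1_cart)
    also have "\<dots> \<le> (\<Sum>i\<in>(UNIV::'n set). C * exp (- c * t))" by (intro sum_mono comp)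
    finally show ?thesis by simp
  qed
  moreover have "CARD('n) * C > 0" "c > 0" using 1 2 by (auto simp: C_def c_def)
  ultimately show ?thesis unfolding converges_exponentially_def by blast
qed

text \<open>The scalar slope is at most \<open>- e * sinh h\<close>, hence at most
  \<open>- e * h\<close>, so an exponential with rate \<open>e / 2\<close> is an upper barrier.
  Positivity of the radii bounds them from below.\<close>

lemma flow_tendsto_zero:
  assumes e: "0 < e" "\<And>x. d * regular_solid_angle x \<le> 4 * pi - e"
  shows "(r \<longlongrightarrow> 0) at_top"
proof -
  define C where "C = 1 + (\<Sum>i\<in>UNIV. r 0 $ i)"
  have le: "r 0 $ i \<le> (\<Sum>i\<in>UNIV. r 0 $ i)" for i
    using flow_pos[of 0] by (intro member_le_sum) (auto intro: less_imp_le)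
  have "0 \<le> (\<Sum>i\<in>UNIV. r 0 $ i)" using flow_pos[of 0] by (intro sum_nonneg) (auto intro: less_imp_le)
  then have C: "0 < C" "r 0 $ i < C" for i using le[of i] by (auto simp: C_def)
  define c where "c = e / 2"
  have c: "c > 0" using e by (simp add: c_def)
  have up: "r t $ i < C * exp (- c * t)" if "0 \<le> t" for t i
  proof (rule flow_upper_barrier[where b' = "\<lambda>t. - c * (C * exp (- c * t))", OF _ _ _ that])
    fix t :: real assume "0 < C * exp (- c * t)"
    define h where "h = C * exp (- c * t)"
    have h: "0 < h" using C by (simp add: h_def)
    have "(d * regular_solid_angle h - 4 * pi) * sinh h \<le> - e * sinh h"
      using e(2)[of h] h by (intro mult_right_mono) auto
    also have "\<dots> \<le> - e * h" using real_le_x_sinh[of h] e h by (auto simp: sinh_field_def exp_minus)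
    also have "\<dots> < - c * h" using e h by (simp add: c_def)
    finally show "(d * regular_solid_angle (C * exp (- c * t)) - 4 * pi) * sinh (C * exp (- c * t))
       < - c * (C * exp (- c * t))" by (simp add: h_def)
  qed (use C in \<open>auto intro!: derivative_eq_intros\<close>)
  have lim: "((\<lambda>t. C * exp (- c * t)) \<longlongrightarrow> 0) at_top"
    using c by real_asymp
  have "((\<lambda>t. r t $ i) \<longlongrightarrow> 0) at_top" for i
  proof (rule tendsto_sandwich[OF _ _ tendsto_const lim])
    show "eventually (\<lambda>t. 0 \<le> r t $ i) at_top"
      using eventually_ge_at_top[of 0] by eventually_elim (simp add: flow_pos less_imp_le)
    show "eventually (\<lambda>t. r t $ i \<le> C * exp (- c * t)) at_top"
      using eventually_ge_at_top[of 0] by eventually_elim (simp only: up less_imp_le)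
  qed
  then show ?thesis by (intro vec_tendstoI) simp
qed

end

section \<open>Constant packings and conclusion\<close>

lemma ex_max_component: "\<exists>i. \<forall>j. r $ j \<le> r $ i" for r :: "real^'n::finite"
proof -
  have "Max (range (\<lambda>i. r $ i)) \<in> range (\<lambda>i. r $ i)" by (rule Max_in) auto
  then obtain i where "Max (range (\<lambda>i. r $ i)) = r $ i" by blast
  moreover have "r $ j \<le> Max (range (\<lambda>i. r $ i))" for j by (rule Max_ge) auto
  ultimately show ?thesis by metis
qed

lemma ex_min_component: "\<exists>i. \<forall>j. r $ i \<le> r $ j" for r :: "real^'n::finite"
  using ex_max_component[of "- r"] by simp

text \<open>Vanishing curvature at a largest radius makes its regular angle at least that of
  \<open>rs\<close>, so this radius is at most \<open>rs\<close>; dually, a smallest radius is at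
  least \<open>rs\<close>.\<close>

lemma vanishing_curvature_unique:
  assumes "tetra_regular T d" "0 < rs" "d * regular_solid_angle rs = 4 * pi" "0 < d"
    and v: "vanishing_curvature T r"
  shows "r = vec rs"
proof -
  have bp: "ball_packing r" using v by (simp add: vanishing_curvature_def real_packing_def)
  then have pos: "r $ i > 0" for i by (simp add: ball_packing_def)
  have K: "ext_curvature T r i = 0" for i
    using v real_packing_ext_curvature by (metis vanishing_curvature_def)
  obtain i where i: "\<And>j. r $ j \<le> r $ i" using ex_max_component by metis
  obtain k where k: "\<And>j. r $ k \<le> r $ j" using ex_min_component by metis
  have "d * regular_solid_angle rs \<le> d * regular_solid_angle (r $ i)"
    using ext_curvature_at_max[OF assms(1) bp i] K[of i] assms(3) by simp
  then have "\<not> regular_solid_angle (r $ i) < regular_solid_angle rs" using \<open>0 < d\<close> by simp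
  then have "r $ i \<le> rs"
    using regular_solid_angle_strict_antimono[OF assms(2)] linorder_not_less by blast
  moreover have "d * regular_solid_angle (r $ k) \<le> d * regular_solid_angle rs"
    using ext_curvature_at_min[OF assms(1) bp k] K[of k] assms(3) by simp
  then have "\<not> regular_solid_angle rs < regular_solid_angle (r $ k)" using \<open>0 < d\<close> by simp
  then have "rs \<le> r $ k"
    using regular_solid_angle_strict_antimono[OF pos] linorder_not_less by blast
  ultimately have "r $ j = rs" for j using i[of j] k[of j] by linarith
  then show ?thesis by (simp add: vec_eq_iff)
qed

text \<open>In a constant packing every vertex is both largest and smallest, so the two curvature
  bounds coincide.\<close>

lemma vanishing_curvature_vec:
  fixes T :: "'n::finite set set"
  assumes "tetra_regular T d" "0 < rs" "d * regular_solid_angle rs = 4 * pi"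
  shows "vanishing_curvature T (vec rs)"
proof -
  have real: "real_packing T (vec rs)" using assms(2) by (rule real_packing_vec)
  then have bp: "ball_packing (vec rs :: real^'n)" unfolding real_packing_def by blast
  have "ext_curvature T (vec rs) i = 0" for i
    using ext_curvature_at_max[OF assms(1) bp, of i] ext_curvature_at_min[OF assms(1) bp, of i]
        assms(3) by simp
  then show ?thesis
    unfolding vanishing_curvature_def real_packing_ext_curvature[OF real, symmetric] using real by blast
qed

theorem corollary1p6:
  fixes M :: "'a topology" and T :: "'n::finite set set" and d :: nat
  assumes "closed_3_manifold M"
    and "triangulates T M"
    and "tetra_regular T d"
  shows "(d \<ge> 23 \<longrightarrow>
            (\<exists>!rbar. vanishing_curvature T rbar) \<and>
            (\<forall>rbar r0 r. vanishing_curvature T rbar \<and> ball_packing r0 \<and> ext_yamabe_flow T r0 r \<longrightarrow>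
               converges_exponentially r rbar)) \<and>
         (d \<le> 22 \<longrightarrow>
            (\<nexists>rbar. vanishing_ext_curvature T rbar) \<and>
            (\<forall>r0 r. ball_packing r0 \<and> ext_yamabe_flow T r0 r \<longrightarrow> (r \<longlongrightarrow> 0) at_top))"
proof (intro conjI impI)
  assume "d \<ge> 23"
  then obtain rs where rs: "rs > 0" "d * regular_solid_angle rs = 4 * pi"
    using regular_angle_sum_eq by blast
  have "0 < d" using \<open>d \<ge> 23\<close> by simp
  note unique = vanishing_curvature_unique[OF assms(3) rs \<open>0 < d\<close>]
  show "\<exists>!rbar. vanishing_curvature T rbar"
    using vanishing_curvature_vec[OF assms(3) rs] unique by blast
  \<comment> \<open>Uniqueness identifies an arbitrary \<open>rbar\<close> with
    \<open>vec rs\<close>.\<close>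
  show "\<forall>rbar r0 r. vanishing_curvature T rbar \<and> ball_packing r0 \<and> ext_yamabe_flow T r0 r \<longrightarrow>
      converges_exponentially r rbar"
    using flow_converges_exponentially[OF assms(3) _ rs \<open>0 < d\<close>] unique by metis
next
  assume "d \<le> 22"
  then obtain e where e: "0 < e" "\<And>x. d * regular_solid_angle x \<le> 4 * pi - e"
    using regular_angle_sum_lt by blast
  show "\<nexists>rbar. vanishing_ext_curvature T rbar"
  proof
    assume "\<exists>rbar. vanishing_ext_curvature T rbar"
    then obtain rbar where v: "ball_packing rbar" "\<And>i. ext_curvature T rbar i = 0"
      by (auto simp: vanishing_ext_curvature_def)
    \<comment> \<open>A vertex of largest radius has extended curvature at least
      \<open>e\<close>.\<close>
    obtain i where "\<And>j. rbar $ j \<le> rbar $ i" using ex_max_component by metis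
    from ext_curvature_at_max[OF assms(3) v(1) this] v(2)[of i] e(1) e(2)[of "rbar $ i"]
    show False by linarith
  qed
  show "\<forall>r0 r. ball_packing r0 \<and> ext_yamabe_flow T r0 r \<longrightarrow> (r \<longlongrightarrow> 0) at_top"
    using flow_tendsto_zero[OF assms(3) _ e] by blast
qed

end
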